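(* Let $d\in\mathbb{N}$, $1\le p<u<\infty$, and let $u'$ be given by $\frac1u+\frac1{u'}=1$. (i) Then $$\ell_1(\mathbb{Z}^d)\hookrightarrow\mathcal{X}_{u,p}(\mathbb{Z}^d)\hookrightarrow\ell_{u'}(\mathbb{Z}^d),$$ and $$\big\|\mathrm{id}:\ell_1(\mathbb{Z}^d)\hookrightarrow\mathcal{X}_{u,p}(\mathbb{Z}^d)\big\|=\big\|\mathrm{id}:\mathcal{X}_{u,p}(\mathbb{Z}^d)\hookrightarrow\ell_{u'}(\mathbb{Z}^d)\big\|=1 .$$ (ii) For $n\in\mathbb{Z}^d$ let $e^{(n)}=\{e^{(n)}_k\}_{k\in\mathbb{Z}^d}$ be given by $e^{(n)}_k=1$ if $n=k$ and $e^{(n)}_k=0$ otherwise. The system $\{e^{(n)}\}_{n\in\mathbb{Z}^d}$ forms a normalised unconditional basis in $\mathcal{X}_{u,p}(\mathbb{Z}^d)$. (iii) $\mathcal{X}_{u,p}(\mathbb{Z}^d)$ is a separable Banach space.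
   Context: For $j\in\mathbb{Z}$, $m\in\mathbb{Z}^d$, the dyadic cubes are $Q_{j,m}=2^{-j}(m+[0,1)^d)\subset\mathbb{R}^d$. Let $1\le p<u<\infty$ and $\frac1p+\frac1{p'}=1$. For $j\in\mathbb{N}_0$, $\mathcal{X}^{(j)}_{u,p}(\mathbb{Z}^d)$ is the space of all $\lambda=\{\lambda_k\}_{k\in\mathbb{Z}^d}\subset\mathbb{C}$ with $$\|\lambda\|^{(j)}_{u,p}=2^{jd(\frac1p-\frac1u)}\sum_{m\in\mathbb{Z}^d}\Big(\sum_{k:\,Q_{0,k}\subset Q_{-j,m}}|\lambda_k|^{p'}\Big)^{1/p'}<\infty$$ (if $p=1$, so $p'=\infty$, the inner expression is the maximum of $|\lambda_k|$ over $k$ with $Q_{0,k}\subset Q_{-j,m}$). The space $\mathcal{X}_{u,p}(\mathbb{Z}^d)$ consists of all sequences $\lambda=\{\lambda_k\}_{k\in\mathbb{Z}^d}\subset\mathbb{C}$ for which there are $\lambda^{(j)}\in\mathcal{X}^{(j)}_{u,p}(\mathbb{Z}^d)$, $j\in\mathbb{N}_0$, with $\lambda=\sum_{j=0}^\infty\lambda^{(j)}$ (coordinatewise) and $\sum_{j=0}^\infty\|\lambda^{(j)}\|^{(j)}_{u,p}<\infty$; it is normed by $\|\lambda|\mathcal{X}_{u,p}\|=\inf\sum_{j=0}^\infty\|\lambda^{(j)}\|^{(j)}_{u,p}$, the infimum being over all such decompositions. $X\hookrightarrow Y$ means $X\subset Y$ with continuous inclusion map $\mathrm{id}$; $\ell_r(\mathbb{Z}^d)$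 is the usual complex sequence space. *)

theory Defs
  imports "HOL-Analysis.Analysis" "HOL-Library.Function_Algebras"
begin

section \<open>Normed spaces of complex families\<close>

text \<open>
  The sequence spaces depend on real parameters, so a normed space is given by a carrier
  set \<open>V\<close> of families \<open>'i \<Rightarrow> complex\<close> and a function \<open>N\<close>, which is relevant on \<open>V\<close> only.
  Sums and differences of families are the pointwise ones of \<open>Function_Algebras\<close>.
\<close>

definition cscale :: "complex \<Rightarrow> ('i \<Rightarrow> complex) \<Rightarrow> 'i \<Rightarrow> complex"
  where "cscale c x = (\<lambda>k. c * x k)"

definition normed_space :: "('i \<Rightarrow> complex) set \<Rightarrow> (('i \<Rightarrow> complex) \<Rightarrow> real) \<Rightarrow> bool"
  where "normed_space V N \<longleftrightarrow>
    0 \<in> V \<and> (\<forall>x\<in>V. \<forall>y\<in>V. x + y \<in> V) \<and> (\<forall>c. \<forall>x\<in>V. cscale c x \<in> V) \<and>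
    (\<forall>x\<in>V. 0 \<le> N x) \<and> (\<forall>x\<in>V. N x = 0 \<longleftrightarrow> x = 0) \<and>
    (\<forall>c. \<forall>x\<in>V. N (cscale c x) = cmod c * N x) \<and>
    (\<forall>x\<in>V. \<forall>y\<in>V. N (x + y) \<le> N x + N y)"

text \<open>
  The value 0 outside \<open>V\<close> is chosen because \<open>Metric_space\<close> requires the distance to be
  nonnegative and symmetric on the whole type.
\<close>

definition norm_dist ::
    "('i \<Rightarrow> complex) set \<Rightarrow> (('i \<Rightarrow> complex) \<Rightarrow> real) \<Rightarrow> ('i \<Rightarrow> complex) \<Rightarrow> ('i \<Rightarrow> complex) \<Rightarrow> real"
  where "norm_dist V N x y = (if x \<in> V \<and> y \<in> V then N (x - y) else 0)"

definition norm_topology ::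
    "('i \<Rightarrow> complex) set \<Rightarrow> (('i \<Rightarrow> complex) \<Rightarrow> real) \<Rightarrow> ('i \<Rightarrow> complex) topology"
  where "norm_topology V N = Metric_space.mtopology V (norm_dist V N)"

definition banach_space :: "('i \<Rightarrow> complex) set \<Rightarrow> (('i \<Rightarrow> complex) \<Rightarrow> real) \<Rightarrow> bool"
  where "banach_space V N \<longleftrightarrow>
    normed_space V N \<and> Metric_space.mcomplete V (norm_dist V N)"

definition continuously_embedded ::
    "('i \<Rightarrow> complex) set \<Rightarrow> (('i \<Rightarrow> complex) \<Rightarrow> real) \<Rightarrow>
     ('i \<Rightarrow> complex) set \<Rightarrow> (('i \<Rightarrow> complex) \<Rightarrow> real) \<Rightarrow> bool"
  where "continuously_embedded V N W M \<longleftrightarrow>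
    normed_space V N \<and> normed_space W M \<and> V \<subseteq> W \<and>
    continuous_map (norm_topology V N) (norm_topology W M) id"

text \<open>Operator norm of \<open>id\<close>; as a supremum in \<open>ereal\<close> it is \<open>\<infinity>\<close> for an unbounded inclusion.\<close>

definition embedding_norm ::
    "('i \<Rightarrow> complex) set \<Rightarrow> (('i \<Rightarrow> complex) \<Rightarrow> real) \<Rightarrow> (('i \<Rightarrow> complex) \<Rightarrow> real) \<Rightarrow> ereal"
  where "embedding_norm V N M = (SUP x\<in>{x\<in>V. N x \<le> 1}. ereal (M x))"

definition series_converges_to ::
    "('i \<Rightarrow> complex) set \<Rightarrow> (('i \<Rightarrow> complex) \<Rightarrow> real) \<Rightarrow> (nat \<Rightarrow> 'i \<Rightarrow> complex) \<Rightarrow>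
     ('i \<Rightarrow> complex) \<Rightarrow> bool"
  where "series_converges_to V N s x \<longleftrightarrow>
    limitin (norm_topology V N) (\<lambda>n. \<Sum>i<n. s i) x sequentially"

definition schauder_basis ::
    "('i \<Rightarrow> complex) set \<Rightarrow> (('i \<Rightarrow> complex) \<Rightarrow> real) \<Rightarrow> (nat \<Rightarrow> 'i \<Rightarrow> complex) \<Rightarrow> bool"
  where "schauder_basis V N b \<longleftrightarrow>
    (\<forall>n. b n \<in> V) \<and>
    (\<forall>x\<in>V. \<exists>!c. series_converges_to V N (\<lambda>n. cscale (c n) (b n)) x)"

text \<open>
  A countable family without preferred order is an unconditional basis if some enumeration
  of it is a Schauder basis and the expansion of every element of the space converges
  unconditionally, i.e. to that element after every rearrangement. As every enumeration is
  covered by the second condition, \<open>c\<close> necessarily consists of the coefficients of \<open>x\<close> with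
  respect to the Schauder basis in the first condition.
\<close>

definition unconditional_basis ::
    "('i \<Rightarrow> complex) set \<Rightarrow> (('i \<Rightarrow> complex) \<Rightarrow> real) \<Rightarrow> ('a \<Rightarrow> 'i \<Rightarrow> complex) \<Rightarrow> bool"
  where "unconditional_basis V N b \<longleftrightarrow>
    (\<exists>\<sigma>::nat \<Rightarrow> 'a. bij \<sigma> \<and> schauder_basis V N (b \<circ> \<sigma>)) \<and>
    (\<forall>x\<in>V. \<exists>c::'a \<Rightarrow> complex. \<forall>\<sigma>::nat \<Rightarrow> 'a. bij \<sigma> \<longrightarrow>
       series_converges_to V N (\<lambda>n. cscale (c (\<sigma> n)) (b (\<sigma> n))) x)"

definition normalised :: "(('i \<Rightarrow> complex) \<Rightarrow> real) \<Rightarrow> ('a \<Rightarrow> 'i \<Rightarrow> complex) \<Rightarrow> bool"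
  where "normalised N b \<longleftrightarrow> (\<forall>n. N (b n) = 1)"


section \<open>The sequence spaces\<close>

definition ell :: "real \<Rightarrow> ('i \<Rightarrow> complex) set"
  where "ell r = {x. (\<lambda>k. cmod (x k) powr r) summable_on UNIV}"

definition ell_norm :: "real \<Rightarrow> ('i \<Rightarrow> complex) \<Rightarrow> real"
  where "ell_norm r x = (\<Sum>\<^sub>\<infinity>k. cmod (x k) powr r) powr (1 / r)"

definition dyadic_cube :: "int \<Rightarrow> int ^ 'd \<Rightarrow> (real ^ 'd) set"
  where "dyadic_cube j m =
    (\<lambda>x. (2 powi (- j)) *\<^sub>R ((\<chi> i. of_int (m $ i)) + x)) ` {x. \<forall>i. 0 \<le> x $ i \<and> x $ i < 1}"

definition subcubes :: "nat \<Rightarrow> int ^ 'd \<Rightarrow> (int ^ 'd) set"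
  where "subcubes j m = {k. dyadic_cube 0 k \<subseteq> dyadic_cube (- int j) m}"

definition conj_exponent :: "real \<Rightarrow> real"
  where "conj_exponent p = 1 / (1 - 1 / p)"

text \<open>The case \<open>p = 1\<close> is the one with conjugate exponent \<open>\<infinity>\<close>.\<close>

definition block_norm :: "real \<Rightarrow> nat \<Rightarrow> (int ^ 'd \<Rightarrow> complex) \<Rightarrow> int ^ 'd \<Rightarrow> real"
  where "block_norm p j x m =
    (if p = 1 then Max ((\<lambda>k. cmod (x k)) ` subcubes j m)
     else (\<Sum>k\<in>subcubes j m. cmod (x k) powr conj_exponent p) powr (1 / conj_exponent p))"

definition level_space :: "real \<Rightarrow> nat \<Rightarrow> (int ^ 'd \<Rightarrow> complex) set"
  where "level_space p j = {x. block_norm p j x summable_on UNIV}"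

definition level_norm :: "real \<Rightarrow> real \<Rightarrow> nat \<Rightarrow> (int ^ 'd \<Rightarrow> complex) \<Rightarrow> real"
  where "level_norm u p j x =
    2 powr (real j * real CARD('d) * (1 / p - 1 / u)) * (\<Sum>\<^sub>\<infinity>m. block_norm p j x m)"

definition decomposition ::
    "real \<Rightarrow> real \<Rightarrow> (int ^ 'd \<Rightarrow> complex) \<Rightarrow> (nat \<Rightarrow> int ^ 'd \<Rightarrow> complex) \<Rightarrow> bool"
  where "decomposition u p x y \<longleftrightarrow>
    (\<forall>j. y j \<in> level_space p j) \<and> (\<forall>k. (\<lambda>j. y j k) sums x k) \<and>
    summable (\<lambda>j. level_norm u p j (y j))"

definition X_space :: "real \<Rightarrow> real \<Rightarrow> (int ^ 'd \<Rightarrow> complex) set"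
  where "X_space u p = {x. \<exists>y. decomposition u p x y}"

definition X_norm :: "real \<Rightarrow> real \<Rightarrow> (int ^ 'd \<Rightarrow> complex) \<Rightarrow> real"
  where "X_norm u p x = (INF y\<in>{y. decomposition u p x y}. \<Sum>j. level_norm u p j (y j))"

definition unit_seq :: "'i \<Rightarrow> 'i \<Rightarrow> complex"
  where "unit_seq n k = (if n = k then 1 else 0)"

end

theory Submission
  imports Defs
begin

text \<open>
  A block at level \<open>j\<close> has \<open>2 ^ (j * d)\<close> points and \<open>1 / u' - 1 / p' = 1 / p - 1 / u\<close>, so the
  power mean inequality on each block says that the weight of the \<open>j\<close>-th level norm is exactly
  what is needed to dominate the \<open>ell u'\<close> norm. Summing over blocks and levels gives
  \<open>ell_norm u' x \<le> X_norm u p x\<close>; the decomposition concentrated at level 0 gives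
  \<open>X_norm u p x \<le> ell_norm 1 x\<close>, and both are equalities at the unit sequences. If \<open>y\<close>
  decomposes \<open>x\<close>, then setting the coordinates in a set \<open>F\<close> to zero in every \<open>y j\<close> decomposes
  the truncated \<open>x\<close>. When \<open>F\<close> contains enough blocks of the first levels, only tails of
  convergent series remain, whatever else \<open>F\<close> contains, so the unit expansion converges
  unconditionally. Completeness follows from countable subadditivity of the norm.
\<close>

section \<open>Finite power norms\<close>

text \<open>For positive arguments this is convexity of the power. If one of them is 0, the claim
  reduces to \<open>c powr q \<le> c\<close> for \<open>c\<close> between 0 and 1.\<close>

lemma powr_convex_combination:
  fixes a b s t q :: real
  assumes "1 \<le> q" "0 \<le> a" "0 \<le> b" "0 \<le> s" "0 \<le> t" "s + t = 1"
  shows "(s * a + t * b) powr q \<le> s * a powr q + t * b powr q"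
proof -
  have scaled: "(c * d) powr q \<le> c * d powr q" if "0 \<le> c" "c \<le> 1" "0 \<le> d" for c d :: real
  proof -
    have "c powr q \<le> c"
      using powr_mono'[of 1 q c] that assms(1) by simp
    then show ?thesis
      using that by (simp add: powr_mult mult_right_mono)
  qed
  consider "a = 0" | "b = 0" | "0 < a" "0 < b"
    using assms by linarith
  then show ?thesis
  proof cases
    case 1 then show ?thesis using scaled[of t b] assms by simp
  next
    case 2 then show ?thesis using scaled[of s a] assms by simp
  next
    case 3
    then show ?thesis
      using powr_convex[OF assms(1)] assms unfolding convex_on_def by fastforce
  qed
qed

text \<open>The \<open>ell r\<close> norm of the part of a family on a finite set. Infinite sums of
  nonnegative terms are suprema over finite sets, so norm estimates can be proved here
  first.\<close>

definition pnorm :: "real \<Rightarrow> 'i set \<Rightarrow> ('i \<Rightarrow> complex) \<Rightarrow> real"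
  where "pnorm r F x = (\<Sum>k\<in>F. cmod (x k) powr r) powr (1 / r)"

lemma pnorm_nonneg: "0 \<le> pnorm r F x"
  by (simp add: pnorm_def)

lemma pnorm_powr:
  assumes "0 < r" shows "pnorm r F x powr r = (\<Sum>k\<in>F. cmod (x k) powr r)"
  using assms by (simp add: pnorm_def powr_powr sum_nonneg)

lemma pnorm_le_iff:
  assumes "0 < r" "0 \<le> C"
  shows "pnorm r F x \<le> C \<longleftrightarrow> (\<Sum>k\<in>F. cmod (x k) powr r) \<le> C powr r"
  unfolding pnorm_powr[OF assms(1), symmetric]
  using assms pnorm_nonneg[of r F x]
  by (metis linorder_not_less powr_less_mono2 powr_mono2 less_imp_le)

lemma pnorm_mono:
  assumes "0 < r" "\<And>k. k \<in> F \<Longrightarrow> cmod (x k) \<le> cmod (y k)"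
  shows "pnorm r F x \<le> pnorm r F y"
  unfolding pnorm_def using assms
  by (intro powr_mono2 sum_mono sum_nonneg) auto

lemma pnorm_subset:
  assumes "0 < r" "finite G" "F \<subseteq> G"
  shows "pnorm r F x \<le> pnorm r G x"
  unfolding pnorm_def using assms
  by (intro powr_mono2 sum_mono2 sum_nonneg) auto

lemma pnorm_singleton [simp]: "0 < r \<Longrightarrow> pnorm r {k} x = cmod (x k)"
  by (simp add: pnorm_def powr_powr)

lemma pnorm_cscale:
  assumes "0 < r" shows "pnorm r F (cscale c x) = cmod c * pnorm r F x"
  using assms by (simp add: pnorm_def cscale_def norm_mult powr_mult powr_powr sum_nonneg
      flip: sum_distrib_left)

text \<open>Minkowski's inequality from convexity: if \<open>x / A\<close> and \<open>y / B\<close>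
  lie in the unit ball, then so does \<open>(x + y) / (A + B)\<close>, their convex combination with
  weights \<open>A / (A + B)\<close> and \<open>B / (A + B)\<close>.\<close>

lemma pnorm_triangle:
  assumes "1 \<le> r"
  shows "pnorm r F (x + y) \<le> pnorm r F x + pnorm r F y"
proof (rule field_le_epsilon)
  \<comment> \<open>The slack \<open>e / 2\<close> makes both normalising constants positive, so
    vanishing norms need no separate treatment.\<close>
  fix e :: real assume "0 < e"
  define A where "A = pnorm r F x + e / 2"
  define B where "B = pnorm r F y + e / 2"
  have pos: "0 < A" "0 < B"
    using \<open>0 < e\<close> pnorm_nonneg[of r F] by (auto simp: A_def B_def add_nonneg_pos)
  have A: "(\<Sum>k\<in>F. cmod (x k) powr r) \<le> A powr r"
    using pnorm_le_iff[of r A F x] assms pos \<open>0 < e\<close> by (simp add: A_def)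
  have B: "(\<Sum>k\<in>F. cmod (y k) powr r) \<le> B powr r"
    using pnorm_le_iff[of r B F y] assms pos \<open>0 < e\<close> by (simp add: B_def)
  have "cmod ((x + y) k) powr r \<le> (A + B) powr r *
      (A / (A + B) * (cmod (x k) powr r / A powr r) + B / (A + B) * (cmod (y k) powr r / B powr r))" for k
  proof -
    have "cmod ((x + y) k) powr r \<le> (cmod (x k) + cmod (y k)) powr r"
      using assms by (intro powr_mono2) (auto simp: norm_triangle_ineq)
    also have "\<dots> = ((A + B) * (A / (A + B) * (cmod (x k) / A) + B / (A + B) * (cmod (y k) / B))) powr r"
      using pos by (simp add: distrib_left)
    also have "\<dots> = (A + B) powr r * (A / (A + B) * (cmod (x k) / A) + B / (A + B) * (cmod (y k) / B)) powr r"
      by (rule powr_mult)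
    also have "\<dots> \<le> (A + B) powr r *
      (A / (A + B) * (cmod (x k) / A) powr r + B / (A + B) * (cmod (y k) / B) powr r)"
      using pos assms
      by (intro mult_left_mono powr_convex_combination) (auto simp flip: add_divide_distrib)
    finally show ?thesis
      using pos by (simp add: powr_divide)
  qed
  then have "(\<Sum>k\<in>F. cmod ((x + y) k) powr r) \<le> (\<Sum>k\<in>F. (A + B) powr r *
      (A / (A + B) * (cmod (x k) powr r / A powr r) + B / (A + B) * (cmod (y k) powr r / B powr r)))"
    by (intro sum_mono)
  also have "\<dots> = (A + B) powr r * (A / (A + B) * ((\<Sum>k\<in>F. cmod (x k) powr r) / A powr r)
      + B / (A + B) * ((\<Sum>k\<in>F. cmod (y k) powr r) / B powr r))"
    by (simp only: sum.distrib flip: sum_distrib_left sum_divide_distrib)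
  also have "\<dots> \<le> (A + B) powr r * (A / (A + B) * 1 + B / (A + B) * 1)"
    using pos A B by (intro mult_left_mono add_mono) auto
  also have "\<dots> = (A + B) powr r"
    using pos by (simp flip: add_divide_distrib)
  finally have "pnorm r F (x + y) \<le> A + B"
    using pos assms by (subst pnorm_le_iff) auto
  then show "pnorm r F (x + y) \<le> pnorm r F x + pnorm r F y + e"
    by (simp add: A_def B_def)
qed

text \<open>Splitting \<open>x\<close> into its part on \<open>F\<close> and its part off
  \<open>F\<close> reduces the claim to the triangle inequality, even for overlapping sets.\<close>

lemma pnorm_Un:
  assumes "1 \<le> r" "finite F" "finite G"
  shows "pnorm r (F \<union> G) x \<le> pnorm r F x + pnorm r G x"
proof -
  define y where "y k = (if k \<in> F then x k else 0)" for k
  define z where "z k = (if k \<in> F then 0 else x k)" for k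
  have "x = y + z"
    by (auto simp: y_def z_def)
  then have "pnorm r (F \<union> G) x \<le> pnorm r (F \<union> G) y + pnorm r (F \<union> G) z"
    using pnorm_triangle[OF assms(1)] by metis
  also have "pnorm r (F \<union> G) y = pnorm r F x"
    unfolding pnorm_def y_def using assms
    by (intro arg_cong[where f="\<lambda>s. s powr _"] sum.mono_neutral_cong_right) auto
  also have "pnorm r (F \<union> G) z = pnorm r (G - F) x"
    unfolding pnorm_def z_def using assms
    by (intro arg_cong[where f="\<lambda>s. s powr _"] sum.mono_neutral_cong_right) auto
  also have "\<dots> \<le> pnorm r G x"
    using assms by (intro pnorm_subset) auto
  finally show ?thesis by simp
qed

lemma pnorm_UN:
  assumes "1 \<le> r" "finite M" "\<And>m. m \<in> M \<Longrightarrow> finite (A m)"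
  shows "pnorm r (\<Union>m\<in>M. A m) x \<le> (\<Sum>m\<in>M. pnorm r (A m) x)"
  using assms(2,3)
proof induction
  case empty
  then show ?case by (simp add: pnorm_def)
next
  case (insert m M)
  then show ?case
    using pnorm_Un[OF assms(1), of "A m" "\<Union>m\<in>M. A m" x] by fastforce
qed

lemma pnorm_le_sum:
  assumes "1 \<le> r" "finite F"
  shows "pnorm r F x \<le> (\<Sum>k\<in>F. cmod (x k))"
  using pnorm_UN[OF assms, of "\<lambda>k. {k}" x] assms by simp

lemma cmod_le_pnorm:
  assumes "0 < r" "finite F" "k \<in> F"
  shows "cmod (x k) \<le> pnorm r F x"
  using pnorm_subset[of r F "{k}" x] assms by simp

text \<open>The power mean inequality: Jensen's inequality for \<open>t powr (q / r)\<close> with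
  equal weights \<open>1 / card F\<close>.\<close>

lemma pnorm_le_pnorm_card:
  assumes "1 \<le> r" "r \<le> q" "finite F"
  shows "pnorm r F x \<le> real (card F) powr (1 / r - 1 / q) * pnorm q F x"
proof (cases "F = {}")
  case True
  then show ?thesis by (simp add: pnorm_def)
next
  case False
  define n where "n = real (card F)"
  have n: "0 < n" using False assms by (simp add: n_def card_gt_0_iff)
  have ratio: "1 \<le> q / r" using assms by (simp add: field_simps)
  have jensen: "convex_on {0..} (\<lambda>t. t powr (q / r))"
    using powr_convex_combination[OF ratio] by (auto simp: convex_on_def)
  have "((\<Sum>k\<in>F. cmod (x k) powr r) / n) powr (q / r)
      = (\<Sum>k\<in>F. (1 / n) *\<^sub>R (cmod (x k) powr r)) powr (q / r)"
    by (simp add: sum_divide_distrib)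
  also have "\<dots> \<le> (\<Sum>k\<in>F. (1 / n) * (cmod (x k) powr r) powr (q / r))"
    using assms False n by (intro convex_on_sum[OF _ _ jensen]) (auto simp: n_def)
  also have "\<dots> = (\<Sum>k\<in>F. cmod (x k) powr q) / n"
    using assms by (simp add: powr_powr sum_divide_distrib)
  finally have "(((\<Sum>k\<in>F. cmod (x k) powr r) / n) powr (q / r)) powr (1 / q)
      \<le> ((\<Sum>k\<in>F. cmod (x k) powr q) / n) powr (1 / q)"
    using assms by (intro powr_mono2) auto
  then have "pnorm r F x / n powr (1 / r) \<le> pnorm q F x / n powr (1 / q)"
    using assms n by (simp add: powr_powr powr_divide pnorm_def sum_nonneg)
  then show ?thesis
    using n by (simp add: n_def[symmetric] powr_diff field_simps)
qed

text \<open>The endpoint \<open>q = \<infinity>\<close> of the power mean inequality, needed for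
  \<open>p = 1\<close>.\<close>

lemma pnorm_le_card_Max:
  assumes "0 < r" "finite F"
  shows "pnorm r F x \<le> real (card F) powr (1 / r) * Max ((\<lambda>k. cmod (x k)) ` F)"
proof (cases "F = {}")
  case True
  then show ?thesis by (simp add: pnorm_def)
next
  case False
  let ?C = "Max ((\<lambda>k. cmod (x k)) ` F)"
  have le: "cmod (x k) \<le> ?C" if "k \<in> F" for k
    using that assms by simp
  then have "0 \<le> ?C"
    using False norm_ge_zero order_trans by blast
  have "(\<Sum>k\<in>F. cmod (x k) powr r) \<le> (\<Sum>k\<in>F. ?C powr r)"
    using le assms by (intro sum_mono powr_mono2) auto
  also have "\<dots> = (real (card F) powr (1 / r) * ?C) powr r"
    using assms \<open>0 \<le> ?C\<close> by (simp add: powr_mult powr_powr)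
  finally show ?thesis
    using assms \<open>0 \<le> ?C\<close> by (subst pnorm_le_iff) auto
qed

text \<open>The triangle inequality handles each partial sum of the series; the remainder is bounded
  by the coordinate errors on \<open>F\<close>, which tend to 0. Stated for an abstract
  \<open>B\<close> so that it serves both the power norms and the maximum.\<close>

lemma seminorm_sums_le:
  fixes B :: "('i \<Rightarrow> complex) \<Rightarrow> real"
  assumes tri: "\<And>x y. B (x + y) \<le> B x + B y"
    and bound: "\<And>x. B x \<le> (\<Sum>k\<in>F. cmod (x k))"
    and sums: "\<And>k. k \<in> F \<Longrightarrow> (\<lambda>j. y j k) sums x k"
    and B: "summable (\<lambda>j. B (y j))"
  shows "B x \<le> (\<Sum>j. B (y j))"
proof -
  have part: "B (\<lambda>k. \<Sum>j<n. y j k) \<le> (\<Sum>j<n. B (y j))" for n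
  proof (induction n)
    case 0
    show ?case using bound[of "\<lambda>_. 0"] by simp
  next
    case (Suc n)
    have "(\<lambda>k. \<Sum>j<Suc n. y j k) = (\<lambda>k. \<Sum>j<n. y j k) + y n"
      by auto
    then show ?case
      using tri[of "\<lambda>k. \<Sum>j<n. y j k" "y n"] Suc by simp
  qed
  have "B x \<le> (\<Sum>j<n. B (y j)) + (\<Sum>k\<in>F. cmod (x k - (\<Sum>j<n. y j k)))" for n
  proof -
    have "x = (\<lambda>k. \<Sum>j<n. y j k) + (\<lambda>k. x k - (\<Sum>j<n. y j k))"
      by auto
    then have "B x \<le> B (\<lambda>k. \<Sum>j<n. y j k) + B (\<lambda>k. x k - (\<Sum>j<n. y j k))"
      using tri by metis
    then show ?thesis
      using part[of n] bound[of "\<lambda>k. x k - (\<Sum>j<n. y j k)"] by linarith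
  qed
  moreover have "(\<lambda>n. (\<Sum>j<n. B (y j)) + (\<Sum>k\<in>F. cmod (x k - (\<Sum>j<n. y j k))))
      \<longlonglongrightarrow> (\<Sum>j. B (y j)) + (\<Sum>k\<in>F. cmod (x k - x k))"
    using sums summable_LIMSEQ[OF B] unfolding sums_def by (intro tendsto_intros) auto
  ultimately show ?thesis
    using LIMSEQ_le_const[of _ _ "B x"] by auto
qed

section \<open>Norms with the conjugate exponent\<close>

text \<open>The block norm detached from cubes: its properties are needed only on finite nonempty
  sets, where \<open>Max\<close> is meaningful.\<close>

definition dual_norm :: "real \<Rightarrow> 'i set \<Rightarrow> ('i \<Rightarrow> complex) \<Rightarrow> real"
  where "dual_norm p F x =
    (if p = 1 then Max ((\<lambda>k. cmod (x k)) ` F) else pnorm (conj_exponent p) F x)"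

lemma conj_exponent_gt_1:
  assumes "1 < p" shows "1 < conj_exponent p"
  using assms by (simp add: conj_exponent_def field_simps)

lemma dual_norm_triangle:
  assumes "1 \<le> p" "finite F" "F \<noteq> {}"
  shows "dual_norm p F (x + y) \<le> dual_norm p F x + dual_norm p F y"
proof (cases "p = 1")
  case True
  have "cmod (x k + y k) \<le> Max ((\<lambda>k. cmod (x k)) ` F) + Max ((\<lambda>k. cmod (y k)) ` F)" if "k \<in> F" for k
    using that assms by (intro order_trans[OF norm_triangle_ineq] add_mono) auto
  then show ?thesis
    using assms True by (simp add: dual_norm_def)
next
  case False
  then show ?thesis
    using pnorm_triangle[of "conj_exponent p"] conj_exponent_gt_1[of p] assms
    by (simp add: dual_norm_def)
qed

lemma dual_norm_mono:
  assumes "1 \<le> p" "finite F" "F \<noteq> {}" "\<And>k. k \<in> F \<Longrightarrow> cmod (x k) \<le> cmod (y k)"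
  shows "dual_norm p F x \<le> dual_norm p F y"
proof (cases "p = 1")
  case True
  have "cmod (x k) \<le> Max ((\<lambda>k. cmod (y k)) ` F)" if "k \<in> F" for k
    using that assms by (intro order_trans[OF assms(4)]) auto
  then show ?thesis
    using assms True by (simp add: dual_norm_def)
next
  case False
  then show ?thesis
    using pnorm_mono[of "conj_exponent p" F x y] conj_exponent_gt_1[of p] assms
    by (simp add: dual_norm_def)
qed

lemma cmod_le_dual_norm:
  assumes "1 \<le> p" "finite F" "k \<in> F"
  shows "cmod (x k) \<le> dual_norm p F x"
  using assms cmod_le_pnorm[of "conj_exponent p" F k x] conj_exponent_gt_1[of p]
  by (auto simp: dual_norm_def)

lemma dual_norm_nonneg:
  assumes "1 \<le> p" "finite F" "F \<noteq> {}"
  shows "0 \<le> dual_norm p F x"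
  using assms cmod_le_dual_norm[OF assms(1,2)] norm_ge_zero order_trans by blast

lemma dual_norm_le_sum:
  assumes "1 \<le> p" "finite F" "F \<noteq> {}"
  shows "dual_norm p F x \<le> (\<Sum>k\<in>F. cmod (x k))"
  using assms pnorm_le_sum[of "conj_exponent p" F] conj_exponent_gt_1[of p]
  by (auto simp: dual_norm_def intro: member_le_sum)

lemma dual_norm_zero:
  assumes "1 \<le> p" "finite F" "F \<noteq> {}" "\<And>k. k \<in> F \<Longrightarrow> x k = 0"
  shows "dual_norm p F x = 0"
  using dual_norm_le_sum[of p F x] dual_norm_nonneg[of p F x] assms by simp

lemma dual_norm_cscale:
  assumes "1 \<le> p" "finite F" "F \<noteq> {}"
  shows "dual_norm p F (cscale c x) = cmod c * dual_norm p F x"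
proof (cases "p = 1")
  case True
  have "Max ((\<lambda>k. cmod c * cmod (x k)) ` F) = cmod c * Max ((\<lambda>k. cmod (x k)) ` F)"
    using assms mono_Max_commute[of "(*) (cmod c)" "(\<lambda>k. cmod (x k)) ` F"]
    by (simp add: mono_def mult_left_mono image_image)
  then show ?thesis
    using True by (simp add: dual_norm_def cscale_def norm_mult)
next
  case False
  then show ?thesis
    using pnorm_cscale[of "conj_exponent p"] conj_exponent_gt_1[of p] assms
    by (simp add: dual_norm_def)
qed

lemma dual_norm_sums_le:
  assumes "1 \<le> p" "finite F" "F \<noteq> {}" "\<And>k. k \<in> F \<Longrightarrow> (\<lambda>j. y j k) sums x k"
    and "summable (\<lambda>j. dual_norm p F (y j))"
  shows "dual_norm p F x \<le> (\<Sum>j. dual_norm p F (y j))"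
  using assms by (intro seminorm_sums_le[of _ F] dual_norm_triangle dual_norm_le_sum) auto

lemma pnorm_sums_le:
  assumes "1 \<le> r" "finite F" "\<And>k. k \<in> F \<Longrightarrow> (\<lambda>j. y j k) sums x k"
    and "summable (\<lambda>j. pnorm r F (y j))"
  shows "pnorm r F x \<le> (\<Sum>j. pnorm r F (y j))"
  using assms by (intro seminorm_sums_le[of _ F] pnorm_triangle pnorm_le_sum) auto

text \<open>With \<open>1 / u + 1 / u' = 1\<close>, the exponent is \<open>1 / u' - 1 / p'\<close> for the conjugate \<open>p'\<close> of \<open>p\<close>.\<close>

lemma pnorm_le_dual_norm:
  assumes "1 \<le> p" "p < u" "1 / u + 1 / u' = 1" "finite F"
  shows "pnorm u' F x \<le> real (card F) powr (1 / p - 1 / u) * dual_norm p F x"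
proof -
  have inv: "1 / u' = 1 - 1 / u" using assms by simp
  have "0 < 1 - 1 / u" "1 - 1 / u \<le> 1" using assms by auto
  then have "0 < 1 / u'" "1 / u' \<le> 1" unfolding inv by auto
  then have u': "1 \<le> u'" by (simp add: field_simps)
  show ?thesis
  proof (cases "p = 1")
    case True
    then show ?thesis
      using pnorm_le_card_Max[of u' F x] u' inv assms by (simp add: dual_norm_def)
  next
    case False
    then have p: "1 < p" using assms by simp
    have cinv: "1 / conj_exponent p = 1 - 1 / p"
      by (simp add: conj_exponent_def)
    \<comment> \<open>Here \<open>p < u\<close> enters: it gives \<open>u' \<le> p'\<close>, the
      order of exponents that the power mean inequality requires.\<close>
    have "1 / conj_exponent p \<le> 1 / u'"
      unfolding cinv inv using assms by (simp add: frac_le)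
    then have "u' \<le> conj_exponent p"
      using u' conj_exponent_gt_1[OF p] by (simp add: field_simps)
    then show ?thesis
      using pnorm_le_pnorm_card[of u' "conj_exponent p" F x] u' assms p
      unfolding inv cinv by (simp add: dual_norm_def)
  qed
qed

section \<open>Normed spaces of families\<close>

lemma sum_fun_apply: "(\<Sum>i\<in>A. f i) k = (\<Sum>i\<in>A. f i k)"
  by (induction A rule: infinite_finite_induct) auto

lemma cscale_1 [simp]: "cscale 1 x = x"
  by (simp add: cscale_def)

lemma cscale_cscale: "cscale a (cscale b x) = cscale (a * b) x"
  by (simp add: cscale_def mult.assoc)

lemma cscale_0 [simp]: "cscale 0 x = 0"
  by (simp add: cscale_def fun_eq_iff)

text \<open>An upper bound for the norm of multiples is enough, since it also applies to the inverse factor.\<close>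

lemma normed_spaceI:
  assumes zero: "0 \<in> V" and zero_le: "N 0 \<le> 0"
    and add: "\<And>x y. x \<in> V \<Longrightarrow> y \<in> V \<Longrightarrow> x + y \<in> V \<and> N (x + y) \<le> N x + N y"
    and scale: "\<And>c x. x \<in> V \<Longrightarrow> cscale c x \<in> V \<and> N (cscale c x) \<le> cmod c * N x"
    and coord: "\<And>x k. x \<in> V \<Longrightarrow> cmod (x k) \<le> N x"
  shows "normed_space V N"
proof -
  have nonneg: "0 \<le> N x" if "x \<in> V" for x
    using coord[OF that] norm_ge_zero order_trans by blast
  have N0: "N 0 = 0" using nonneg[OF zero] zero_le by simp
  have "N (cscale c x) = cmod c * N x" if "x \<in> V" for c x
  proof (cases "c = 0")
    case True
    then show ?thesis by (simp add: N0)
  next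
    case False
    have "N x = N (cscale (1 / c) (cscale c x))"
      using False by (simp add: cscale_cscale)
    also have "\<dots> \<le> cmod (1 / c) * N (cscale c x)"
      using scale that by blast
    finally have "cmod c * N x \<le> N (cscale c x)"
      using False by (simp add: norm_divide field_simps)
    then show ?thesis using scale[OF that, of c] by simp
  qed
  moreover have "N x = 0 \<longleftrightarrow> x = 0" if "x \<in> V" for x
  proof
    assume "N x = 0"
    then show "x = 0"
      using coord[OF that] by (simp add: fun_eq_iff)
  qed (simp add: N0)
  ultimately show ?thesis
    unfolding normed_space_def by (intro conjI ballI allI) (simp_all add: zero add scale nonneg)
qed

lemma normed_space_triangle:
  "normed_space V N \<Longrightarrow> x \<in> V \<Longrightarrow> y \<in> V \<Longrightarrow> N (x + y) \<le> N x + N y"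
  by (simp add: normed_space_def)

lemma normed_space_minus:
  assumes "normed_space V N" "x \<in> V" "y \<in> V"
  shows "x - y \<in> V" "N (x - y) = N (y - x)"
proof -
  have diff: "a - b = a + cscale (- 1) b" for a b :: "'a \<Rightarrow> complex"
    by (simp add: cscale_def fun_eq_iff)
  show "x - y \<in> V"
    unfolding diff using assms by (simp add: normed_space_def)
  have "y - x \<in> V"
    unfolding diff using assms by (simp add: normed_space_def)
  moreover have "x - y = cscale (- 1) (y - x)"
    by (simp add: cscale_def fun_eq_iff)
  ultimately show "N (x - y) = N (y - x)"
    using assms(1) by (simp add: normed_space_def)
qed

lemma normed_space_sum:
  assumes "normed_space V N" "\<And>i. i \<in> A \<Longrightarrow> s i \<in> V"
  shows "sum s A \<in> V"
  using assms(2)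
  by (induction A rule: infinite_finite_induct) (use assms(1) in \<open>auto simp: normed_space_def\<close>)

lemma Metric_space_norm_dist:
  assumes "normed_space V N"
  shows "Metric_space V (norm_dist V N)"
proof
  fix x y
  show "0 \<le> norm_dist V N x y"
    using assms normed_space_minus[OF assms] by (auto simp: norm_dist_def normed_space_def)
  show "norm_dist V N x y = norm_dist V N y x"
    using normed_space_minus[OF assms] by (auto simp: norm_dist_def)
next
  fix x y assume "x \<in> V" "y \<in> V"
  then show "norm_dist V N x y = 0 \<longleftrightarrow> x = y"
    using assms normed_space_minus[OF assms] by (auto simp: norm_dist_def normed_space_def)
next
  fix x y z assume V: "x \<in> V" "y \<in> V" "z \<in> V"
  have "N ((x - y) + (y - z)) \<le> N (x - y) + N (y - z)"
    by (intro normed_space_triangle[OF assms] normed_space_minus(1)[OF assms] V)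
  then show "norm_dist V N x z \<le> norm_dist V N x y + norm_dist V N y z"
    using V by (simp add: norm_dist_def)
qed

text \<open>An inclusion that does not increase the norm is 1-Lipschitz, so
  \<open>\<delta> = e\<close> works in the continuity criterion.\<close>

lemma continuously_embeddedI:
  assumes V: "normed_space V N" and W: "normed_space W M"
    and le: "\<And>x. x \<in> V \<Longrightarrow> x \<in> W \<and> M x \<le> N x"
  shows "continuously_embedded V N W M"
proof -
  interpret V: Metric_space V "norm_dist V N" by (rule Metric_space_norm_dist[OF V])
  have "norm_dist W M a x \<le> norm_dist V N a x" if "a \<in> V" "x \<in> V" for a x
    using le that normed_space_minus[OF V] by (simp add: norm_dist_def)
  then have "\<forall>a\<in>V. \<forall>e>0. \<exists>\<delta>>0. \<forall>x. x \<in> V \<and> norm_dist V N a x < \<delta> \<longrightarrow> norm_dist W M a x < e"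
    by (meson order.strict_trans1)
  then have "continuous_map (norm_topology V N) (norm_topology W M) id"
    unfolding norm_topology_def V.metric_continuous_map[OF Metric_space_norm_dist[OF W]]
    using le by auto
  then show ?thesis
    using V W le by (auto simp: continuously_embedded_def)
qed

text \<open>Domination bounds the supremum by 1, and the vector \<open>e\<close> attains this
  value.\<close>

lemma embedding_norm_eq_1:
  assumes "\<And>x. x \<in> V \<Longrightarrow> M x \<le> N x" "e \<in> V" "N e = 1" "M e = 1"
  shows "embedding_norm V N M = 1"
proof (rule antisym)
  show "embedding_norm V N M \<le> 1"
    unfolding embedding_norm_def using assms by (intro SUP_least) (fastforce simp: one_ereal_def)
  show "1 \<le> embedding_norm V N M"
    unfolding embedding_norm_def using assms by (intro SUP_upper2[of e]) auto
qed

text \<open>Since all terms lie in \<open>V\<close>, the default value of \<open>norm_dist\<close>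
  outside the carrier never interferes, and convergence is that of the norms of the
  differences.\<close>

lemma limitin_norm_topology:
  assumes "normed_space V N" "\<And>n. f n \<in> V"
  shows "limitin (norm_topology V N) f x sequentially \<longleftrightarrow> x \<in> V \<and> (\<lambda>n. N (f n - x)) \<longlonglongrightarrow> 0"
proof -
  interpret Metric_space V "norm_dist V N" by (rule Metric_space_norm_dist[OF assms(1)])
  show ?thesis
    unfolding norm_topology_def limitin_metric_dist_null using assms(2)
    by (auto simp: norm_dist_def)
qed

text \<open>A fast Cauchy subsequence has absolutely summable increments.\<close>

lemma banach_spaceI:
  fixes V :: "('i \<Rightarrow> complex) set"
  assumes V: "normed_space V N"
    and series: "\<And>d. (\<And>i. d i \<in> V) \<Longrightarrow> summable (\<lambda>i. N (d i)) \<Longrightarrow>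
      \<exists>x\<in>V. (\<lambda>n. N ((\<Sum>i<n. d i) - x)) \<longlonglongrightarrow> 0"
  shows "banach_space V N"
proof -
  interpret Metric_space V "norm_dist V N" by (rule Metric_space_norm_dist[OF V])
  have "\<exists>x. limitin mtopology \<sigma> x sequentially" if cauchy: "MCauchy \<sigma>" for \<sigma>
  proof -
    have \<sigma>: "\<sigma> n \<in> V" for n
      using cauchy by (auto simp: MCauchy_def)
    have "\<forall>i. \<exists>n. \<forall>k\<ge>n. \<forall>l\<ge>n. norm_dist V N (\<sigma> k) (\<sigma> l) < (1 / 2) ^ i"
      using cauchy unfolding MCauchy_def
      by (metis zero_less_divide_1_iff zero_less_numeral zero_less_power)
    then obtain g where g: "\<And>i k l. g i \<le> k \<Longrightarrow> g i \<le> l \<Longrightarrow> norm_dist V N (\<sigma> k) (\<sigma> l) < (1 / 2) ^ i"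
      by metis
    \<comment> \<open>The summand \<open>n\<close> makes \<open>r\<close> strictly increasing; the
      sum of the \<open>g i\<close> ensures \<open>r n \<ge> g n\<close>, so consecutive terms of
      the subsequence are within \<open>(1 / 2) ^ n\<close>.\<close>
    define r where "r n = n + (\<Sum>i\<le>n. g i)" for n
    have r: "strict_mono r"
      by (simp add: strict_mono_Suc_iff r_def)
    have g_le: "g n \<le> r n" for n
      by (simp add: r_def trans_le_add2 member_le_sum)
    define d where "d i = \<sigma> (r (Suc i)) - \<sigma> (r i)" for i
    have d: "d i \<in> V" for i
      unfolding d_def by (intro normed_space_minus(1)[OF V] \<sigma>)
    have "N (d i) \<le> (1 / 2) ^ i" for i
    proof -
      have "norm_dist V N (\<sigma> (r (Suc i))) (\<sigma> (r i)) < (1 / 2) ^ i"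
        using g_le[of i] strict_mono_less_eq[OF r, of i "Suc i"] by (intro g) auto
      then show ?thesis using \<sigma> by (simp add: norm_dist_def d_def)
    qed
    moreover have "0 \<le> N (d i)" for i
      using V d by (simp add: normed_space_def)
    ultimately have "summable (\<lambda>i. N (d i))"
      by (intro summable_comparison_test'[OF summable_geometric[of "1 / 2"], of 0]) auto
    then obtain x where x: "x \<in> V" "(\<lambda>n. N ((\<Sum>i<n. d i) - x)) \<longlonglongrightarrow> 0"
      using series d by blast
    \<comment> \<open>The increments telescope; adding back the starting point
      \<open>\<sigma> (r 0)\<close> turns the sum of the series into the limit of the
      subsequence.\<close>
    have "(\<Sum>i<n. d i) = \<sigma> (r n) - \<sigma> (r 0)" for n
      unfolding d_def by (induction n) auto
    then have "(\<Sum>i<n. d i) - x = (\<sigma> \<circ> r) n - (x + \<sigma> (r 0))" for n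
      by simp
    moreover have "x + \<sigma> (r 0) \<in> V"
      using V x \<sigma> by (simp add: normed_space_def)
    ultimately have "limitin (norm_topology V N) (\<sigma> \<circ> r) (x + \<sigma> (r 0)) sequentially"
      using x(2) \<sigma> limitin_norm_topology[OF V, of "\<sigma> \<circ> r"] by (simp only: o_apply)
    then have "limitin mtopology (\<sigma> \<circ> r) (x + \<sigma> (r 0)) sequentially"
      by (simp only: norm_topology_def)
    then show ?thesis
      using MCauchy_convergent_subsequence[OF cauchy r] by blast
  qed
  then show ?thesis
    using V by (simp add: banach_space_def mcomplete_def)
qed

section \<open>The spaces of summable powers\<close>

text \<open>A uniform bound on finite sections of a nonnegative series yields convergence and the
  same bound for the sum, hence membership and the norm estimate at once.\<close>

lemma ell_normI:
  assumes "0 < r" "0 \<le> C" "\<And>F. finite F \<Longrightarrow> pnorm r F x \<le> C"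
  shows "x \<in> ell r" "ell_norm r x \<le> C"
proof -
  have bound: "(\<Sum>k\<in>F. cmod (x k) powr r) \<le> C powr r" if "finite F" for F
    using assms that pnorm_le_iff by blast
  have summ: "(\<lambda>k. cmod (x k) powr r) summable_on UNIV"
    using bound by (intro nonneg_bdd_above_summable_on) (auto simp: bdd_above_def)
  then show "x \<in> ell r" by (simp add: ell_def)
  have "(\<Sum>\<^sub>\<infinity>k. cmod (x k) powr r) \<le> C powr r"
    using bound by (intro infsum_le_finite_sums[OF summ])
  then have "ell_norm r x \<le> (C powr r) powr (1 / r)"
    unfolding ell_norm_def using assms by (intro powr_mono2) (auto simp: infsum_nonneg)
  then show "ell_norm r x \<le> C"
    using assms by (simp add: powr_powr)
qed

lemma pnorm_le_ell_norm:
  assumes "0 < r" "x \<in> ell r" "finite F"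
  shows "pnorm r F x \<le> ell_norm r x"
  unfolding pnorm_def ell_norm_def using assms
  by (intro powr_mono2 finite_sum_le_infsum) (auto simp: ell_def sum_nonneg)

lemma ell_norm_nonneg: "0 \<le> ell_norm r x"
  by (simp add: ell_norm_def)

lemma cmod_le_ell_norm:
  assumes "0 < r" "x \<in> ell r" shows "cmod (x k) \<le> ell_norm r x"
  using pnorm_le_ell_norm[OF assms, of "{k}"] assms by simp

lemma normed_space_ell:
  assumes "1 \<le> r"
  shows "normed_space (ell r :: ('i \<Rightarrow> complex) set) (ell_norm r)"
proof (rule normed_spaceI)
  have "pnorm r F (0 :: 'i \<Rightarrow> complex) \<le> 0" if "finite F" for F
    using pnorm_le_sum[OF assms that, of 0] by simp
  note zero = ell_normI[OF _ order_refl this]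
  show "(0 :: 'i \<Rightarrow> complex) \<in> ell r" "ell_norm r (0 :: 'i \<Rightarrow> complex) \<le> 0"
    using assms by (auto intro: zero)
  fix x y :: "'i \<Rightarrow> complex" assume x: "x \<in> ell r"
  show "cmod (x k) \<le> ell_norm r x" for k
    using x assms by (intro cmod_le_ell_norm) auto
  have "pnorm r F (cscale c x) \<le> cmod c * ell_norm r x" if "finite F" for c F
    using pnorm_le_ell_norm[of r x F] x that assms by (simp add: pnorm_cscale mult_left_mono)
  then show "cscale c x \<in> ell r \<and> ell_norm r (cscale c x) \<le> cmod c * ell_norm r x" for c
    using ell_normI[of r "cmod c * ell_norm r x" "cscale c x"] assms by (simp add: ell_norm_nonneg)
  assume y: "y \<in> ell r"
  have "pnorm r F (x + y) \<le> ell_norm r x + ell_norm r y" if "finite F" for F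
    using pnorm_triangle[OF assms, of F x y] pnorm_le_ell_norm[of r _ F] x y that assms
    by (smt (verit))
  then show "x + y \<in> ell r \<and> ell_norm r (x + y) \<le> ell_norm r x + ell_norm r y"
    using ell_normI[of r "ell_norm r x + ell_norm r y" "x + y"] assms by (simp add: ell_norm_nonneg)
qed

lemma finite_support_ell_1:
  assumes "finite F" "\<And>k. k \<notin> F \<Longrightarrow> x k = 0"
  shows "x \<in> ell 1" "ell_norm 1 x = (\<Sum>k\<in>F. cmod (x k))"
proof -
  have "((\<lambda>k. cmod (x k)) has_sum (\<Sum>k\<in>F. cmod (x k))) UNIV"
    using assms by (intro has_sum_finite_neutralI) auto
  then show "x \<in> ell 1" "ell_norm 1 x = (\<Sum>k\<in>F. cmod (x k))"
    by (auto simp: ell_def ell_norm_def has_sum_iff sum_nonneg)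
qed

lemma unit_seq_in_ell:
  assumes "0 < r" shows "unit_seq n \<in> ell r" "ell_norm r (unit_seq n) = 1"
proof -
  have "((\<lambda>k. cmod (unit_seq n k) powr r) has_sum (\<Sum>k\<in>{n}. cmod (unit_seq n k) powr r)) UNIV"
    by (rule has_sum_finite_neutralI[of "{n}"]) (auto simp: unit_seq_def)
  then have "((\<lambda>k. cmod (unit_seq n k) powr r) has_sum 1) UNIV"
    by (simp add: unit_seq_def)
  then show "unit_seq n \<in> ell r" "ell_norm r (unit_seq n) = 1"
    by (auto simp: ell_def ell_norm_def has_sum_iff)
qed

lemma unit_expansion_partial_sum:
  fixes \<sigma> :: "nat \<Rightarrow> 'i"
  assumes "inj \<sigma>"
  shows "(\<Sum>i<n. cscale (c i) (unit_seq (\<sigma> i))) (\<sigma> m) = (if m < n then c m else 0)"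
proof -
  have "(\<Sum>i<n. cscale (c i) (unit_seq (\<sigma> i))) (\<sigma> m) = (\<Sum>i<n. if i = m then c i else 0)"
    unfolding sum_fun_apply using assms
    by (intro sum.cong) (auto simp: cscale_def unit_seq_def inj_eq)
  then show ?thesis by simp
qed

section \<open>Dyadic cubes\<close>

lemma mem_dyadic_cube:
  "x \<in> dyadic_cube j m \<longleftrightarrow>
    (\<forall>i. of_int (m $ i) \<le> 2 powi j * x $ i \<and> 2 powi j * x $ i < of_int (m $ i) + 1)"
proof -
  have scale: "(2::real) powi j * 2 powi (- j) = 1"
    by (simp flip: power_int_add)
  have "x \<in> dyadic_cube j m \<longleftrightarrow> (\<exists>y. (\<forall>i. 0 \<le> y $ i \<and> y $ i < 1) \<and>
      x = (2 powi (- j)) *\<^sub>R ((\<chi> i. of_int (m $ i)) + y))"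
    unfolding dyadic_cube_def by auto
  also have "\<dots> \<longleftrightarrow> (\<exists>y. (\<forall>i. 0 \<le> y $ i \<and> y $ i < 1) \<and>
      y = (2 powi j) *\<^sub>R x - (\<chi> i. of_int (m $ i)))"
  proof -
    have "x = (2 powi (- j)) *\<^sub>R v + 0 \<longleftrightarrow> v = (2 powi j) *\<^sub>R x" for v
      using scale by (auto simp: scaleR_scaleR mult.commute)
    then show ?thesis
      by (metis add.commute add.right_neutral add_diff_cancel_left' diff_add_cancel)
  qed
  also have "\<dots> \<longleftrightarrow> (\<forall>i. of_int (m $ i) \<le> 2 powi j * x $ i \<and> 2 powi j * x $ i < of_int (m $ i) + 1)"
    by (auto simp: diff_less_eq add.commute)
  finally show ?thesis .
qed

text \<open>The index of the cube of side \<open>2 ^ j\<close> that contains the lattice point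
  \<open>k\<close>; \<open>div\<close> rounds down, which is also right for negative
  coordinates.\<close>

definition parent :: "nat \<Rightarrow> int ^ 'd \<Rightarrow> int ^ 'd"
  where "parent j k = (\<chi> i. k $ i div 2 ^ j)"

text \<open>A unit cube can only lie in the larger cube that contains its lower corner, and rounding
  \<open>k / 2 ^ j\<close> down coordinatewise finds that cube. Thus the blocks of one level are
  fibres of \<open>parent\<close> and partition the lattice.\<close>

lemma subcubes_eq: "subcubes j m = {k. parent j k = m}"
proof -
  have corner: "(of_int a \<le> 2 powi (- int j) * real_of_int b \<and>
      2 powi (- int j) * real_of_int b < of_int a + 1) \<longleftrightarrow> b div 2 ^ j = a" for a b :: int
  proof -
    have "(of_int a \<le> 2 powi (- int j) * real_of_int b \<and>
        2 powi (- int j) * real_of_int b < of_int a + 1) \<longleftrightarrow>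
        \<lfloor>real_of_int b / real_of_int (2 ^ j)\<rfloor> = a"
      by (simp add: floor_eq_iff power_int_minus divide_inverse mult.commute)
    then show ?thesis
      by (simp only: floor_divide_of_int_eq)
  qed
  \<comment> \<open>For the half-open upper faces integrality matters:
    \<open>b < (a + 1) * 2 ^ j\<close> between integers leaves room for the whole unit edge above
    \<open>b\<close>.\<close>
  have edge: "2 powi (- int j) * t < of_int a + 1"
    if "b div 2 ^ j = a" "t < real_of_int b + 1" for a b :: int and t :: real
  proof -
    have "b < (a + 1) * 2 ^ j"
      using that(1) by (metis div_mult_mod_eq distrib_right mult_1 add_strict_left_mono
          pos_mod_bound zero_less_numeral zero_less_power)
    then have "b + 1 \<le> (a + 1) * 2 ^ j" by simp
    then have "real_of_int (b + 1) \<le> real_of_int ((a + 1) * 2 ^ j)"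
      by (simp only: of_int_le_iff)
    then have "t < (of_int a + 1) * 2 ^ j"
      using that(2) by simp
    then show ?thesis
      by (simp add: power_int_minus field_simps)
  qed
  have "dyadic_cube 0 k \<subseteq> dyadic_cube (- int j) m \<longleftrightarrow> (\<forall>i. k $ i div 2 ^ j = m $ i)" for k
  proof
    assume "dyadic_cube 0 k \<subseteq> dyadic_cube (- int j) m"
    moreover have "(\<chi> i. real_of_int (k $ i)) \<in> dyadic_cube 0 k"
      by (simp add: mem_dyadic_cube)
    ultimately have "(\<chi> i. real_of_int (k $ i)) \<in> dyadic_cube (- int j) m"
      by blast
    then show "\<forall>i. k $ i div 2 ^ j = m $ i"
      unfolding mem_dyadic_cube vec_lambda_beta corner .
  next
    assume k: "\<forall>i. k $ i div 2 ^ j = m $ i"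
    show "dyadic_cube 0 k \<subseteq> dyadic_cube (- int j) m"
    proof
      fix x assume x: "x \<in> dyadic_cube 0 k"
      have "of_int (m $ i) \<le> 2 powi (- int j) * x $ i" for i
      proof -
        have "of_int (m $ i) \<le> 2 powi (- int j) * real_of_int (k $ i)"
          using k corner by blast
        also have "\<dots> \<le> 2 powi (- int j) * x $ i"
          using x by (intro mult_left_mono) (auto simp: mem_dyadic_cube)
        finally show ?thesis .
      qed
      moreover have "2 powi (- int j) * x $ i < of_int (m $ i) + 1" for i
        using x k by (intro edge[of "k $ i"]) (auto simp: mem_dyadic_cube)
      ultimately show "x \<in> dyadic_cube (- int j) m"
        by (simp add: mem_dyadic_cube)
    qed
  qed
  then show ?thesis
    by (auto simp: subcubes_def parent_def vec_eq_iff)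
qed

text \<open>A block is a product of integer intervals, one per coordinate, each with
  \<open>2 ^ j\<close> points.\<close>

lemma card_subcubes: "card (subcubes j (m :: int ^ 'd)) = 2 ^ (j * CARD('d))"
proof -
  define S where "S i = {2 ^ j * m $ i ..< 2 ^ j * (m $ i + 1)}" for i
  have "a div 2 ^ j = b \<longleftrightarrow> 2 ^ j * b \<le> a \<and> a < 2 ^ j * (b + 1)" for a b :: int
  proof
    assume "a div 2 ^ j = b"
    then have "a = 2 ^ j * b + a mod 2 ^ j"
      by (metis mult_div_mod_eq)
    moreover have "0 \<le> a mod 2 ^ j" "a mod 2 ^ j < 2 ^ j"
      by simp_all
    ultimately show "2 ^ j * b \<le> a \<and> a < 2 ^ j * (b + 1)"
      unfolding distrib_left by linarith
  next
    assume "2 ^ j * b \<le> a \<and> a < 2 ^ j * (b + 1)"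
    then show "a div 2 ^ j = b"
      by (intro int_div_pos_eq[of _ _ _ "a - 2 ^ j * b"]) (auto simp: distrib_left)
  qed
  then have "subcubes j m = {k. \<forall>i. k $ i \<in> S i}"
    by (auto simp: subcubes_eq parent_def vec_eq_iff S_def)
  moreover have "bij_betw vec_nth {k :: int ^ 'd. \<forall>i. k $ i \<in> S i} (PiE UNIV S)"
    by (rule bij_betw_byWitness[of _ vec_lambda]) auto
  ultimately have "card (subcubes j m) = (\<Prod>i\<in>UNIV. card (S i))"
    by (simp add: bij_betw_same_card card_PiE)
  moreover have "card (S i) = 2 ^ j" for i
    by (simp add: S_def algebra_simps nat_power_eq)
  ultimately show ?thesis
    by (simp add: power_mult)
qed

lemma finite_subcubes [simp]: "finite (subcubes j m)"
  using card_subcubes[of j m] by (intro card_ge_0_finite) simp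

lemma subcubes_nonempty [simp]: "subcubes j m \<noteq> {}"
  using card_subcubes[of j m] by force

lemma subcubes_0 [simp]: "subcubes 0 m = {m}"
  by (auto simp: subcubes_eq parent_def)

lemma block_norm_eq: "block_norm p j x m = dual_norm p (subcubes j m) x"
  by (simp add: block_norm_def dual_norm_def pnorm_def)

section \<open>The level spaces\<close>

text \<open>The complementary truncation: for finite \<open>F\<close> it is what remains of
  \<open>x\<close> after the terms of its unit expansion with index in \<open>F\<close> are
  subtracted.\<close>

definition remove_coords :: "'i set \<Rightarrow> ('i \<Rightarrow> complex) \<Rightarrow> 'i \<Rightarrow> complex"
  where "remove_coords F x = (\<lambda>k. if k \<in> F then 0 else x k)"

locale sequence_exponents =
  fixes p u u' :: real
  assumes p_ge_1: "1 \<le> p" and p_less_u: "p < u" and conjugate: "1 / u + 1 / u' = 1"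
begin

text \<open>As \<open>u > 1\<close>, the reciprocal of \<open>u'\<close> lies in the half-open
  interval from 0 (excluded) to 1. Strict positivity rules out \<open>u' = 0\<close>, where the
  quotient \<open>1 / u'\<close> would be 0 by convention.\<close>

lemma u'_ge_1: "1 \<le> u'"
proof -
  have inv: "1 / u' = 1 - 1 / u" using conjugate by simp
  have "0 < 1 - 1 / u" "1 - 1 / u \<le> 1" using p_ge_1 p_less_u by auto
  then have "0 < 1 / u'" "1 / u' \<le> 1" unfolding inv by auto
  then show ?thesis by (simp add: field_simps)
qed

lemma block_norm_nonneg: "0 \<le> block_norm p j x m"
  by (simp add: block_norm_eq dual_norm_nonneg p_ge_1)

lemma level_partial_sum_le:
  fixes x :: "int ^ 'd \<Rightarrow> complex"
  assumes "x \<in> level_space p j" "finite M"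
  shows "2 powr (real j * real CARD('d) * (1 / p - 1 / u)) * (\<Sum>m\<in>M. block_norm p j x m)
    \<le> level_norm u p j x"
  unfolding level_norm_def using assms
  by (intro mult_left_mono finite_sum_le_infsum) (auto simp: level_space_def block_norm_nonneg)

lemma level_normI:
  fixes x :: "int ^ 'd \<Rightarrow> complex"
  assumes "\<And>M. finite M \<Longrightarrow>
    2 powr (real j * real CARD('d) * (1 / p - 1 / u)) * (\<Sum>m\<in>M. block_norm p j x m) \<le> C"
  shows "x \<in> level_space p j" "level_norm u p j x \<le> C"
proof -
  define w where "w = (2::real) powr (real j * real CARD('d) * (1 / p - 1 / u))"
  have "0 < w" by (simp add: w_def)
  have bound: "(\<Sum>m\<in>M. block_norm p j x m) \<le> C / w" if "finite M" for M
    using assms[OF that, folded w_def] \<open>0 < w\<close> by (simp add: field_simps)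
  then have summ: "block_norm p j x summable_on UNIV"
    by (intro nonneg_bdd_above_summable_on) (auto simp: block_norm_nonneg bdd_above_def)
  then show "x \<in> level_space p j" by (simp add: level_space_def)
  have "(\<Sum>\<^sub>\<infinity>m. block_norm p j x m) \<le> C / w"
    using bound by (intro infsum_le_finite_sums[OF summ])
  then show "level_norm u p j x \<le> C"
    unfolding level_norm_def w_def[symmetric] using \<open>0 < w\<close> by (simp add: field_simps)
qed

lemma level_norm_nonneg: "0 \<le> level_norm u p j x"
  by (simp add: level_norm_def infsum_nonneg block_norm_nonneg)

text \<open>Solidity: block norms depend monotonically on the moduli of the coordinates. Truncating
  an admissible family therefore keeps it admissible.\<close>

lemma level_norm_mono:
  assumes "y \<in> level_space p j" "\<And>k. cmod (x k) \<le> cmod (y k)"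
  shows "x \<in> level_space p j" "level_norm u p j x \<le> level_norm u p j y"
proof -
  have "block_norm p j x m \<le> block_norm p j y m" for m
    using assms by (simp add: block_norm_eq dual_norm_mono p_ge_1)
  then have *: "2 powr (real j * real CARD('a) * (1 / p - 1 / u)) * (\<Sum>m\<in>M. block_norm p j x m)
      \<le> level_norm u p j y" if "finite M" for M
    using level_partial_sum_le[OF assms(1) that] 
    by (smt (verit) mult_left_mono powr_ge_zero sum_mono)
  show "x \<in> level_space p j" "level_norm u p j x \<le> level_norm u p j y"
    by (rule level_normI[OF *], assumption)+
qed

lemma level_norm_cscale:
  assumes "x \<in> level_space p j"
  shows "cscale c x \<in> level_space p j" "level_norm u p j (cscale c x) = cmod c * level_norm u p j x"
proof -
  have eq: "block_norm p j (cscale c x) = (\<lambda>m. cmod c * block_norm p j x m)"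
    by (simp add: fun_eq_iff block_norm_eq dual_norm_cscale p_ge_1)
  show "cscale c x \<in> level_space p j"
    using assms by (simp add: level_space_def eq summable_on_cmult_right)
  show "level_norm u p j (cscale c x) = cmod c * level_norm u p j x"
    by (simp add: level_norm_def eq infsum_cmult_right')
qed

lemma zero_level: "(\<lambda>_. 0) \<in> level_space p j" "level_norm u p j (\<lambda>_. 0) = 0"
proof -
  have "block_norm p j (\<lambda>_. 0) m = 0" for m
    by (simp add: block_norm_eq dual_norm_zero p_ge_1)
  then have eq: "block_norm p j (\<lambda>_. 0) = (\<lambda>_. 0)" by blast
  then show "(\<lambda>_. 0) \<in> level_space p j" "level_norm u p j (\<lambda>_. 0) = 0"
    unfolding level_space_def level_norm_def mem_Collect_eq eq
    by (simp_all add: summable_on_0)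
qed

text \<open>Countable subadditivity within one level: on finitely many blocks it follows from that
  of the block norms by exchanging a finite sum with a series, and the bound does not depend on the
  blocks chosen.\<close>

lemma level_norm_sums_le:
  fixes y :: "nat \<Rightarrow> int ^ 'd \<Rightarrow> complex"
  assumes level: "\<And>i. y i \<in> level_space p j"
    and summ: "summable (\<lambda>i. level_norm u p j (y i))"
    and sums: "\<And>k. (\<lambda>i. y i k) sums z k"
  shows "z \<in> level_space p j" "level_norm u p j z \<le> (\<Sum>i. level_norm u p j (y i))"
proof -
  define w where "w = (2::real) powr (real j * real CARD('d) * (1 / p - 1 / u))"
  have "0 < w" by (simp add: w_def)
  note partial = level_partial_sum_le[OF level, folded w_def]
  \<comment> \<open>A single weighted block norm is at most the whole level norm, by the case of a
    one-element \<open>M\<close>.\<close>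
  have block: "summable (\<lambda>i. w * block_norm p j (y i) m)" for m
    using partial[of "{m}"] \<open>0 < w\<close>
    by (intro summable_comparison_test'[OF summ, of 0]) (simp add: block_norm_nonneg)
  then have block': "summable (\<lambda>i. block_norm p j (y i) m)" for m
    using \<open>0 < w\<close> by (simp add: summable_cmult_iff)
  have *: "w * (\<Sum>m\<in>M. block_norm p j z m) \<le> (\<Sum>i. level_norm u p j (y i))" if "finite M" for M
  proof -
    have "w * (\<Sum>m\<in>M. block_norm p j z m) \<le> w * (\<Sum>m\<in>M. \<Sum>i. block_norm p j (y i) m)"
      using \<open>0 < w\<close> block' sums
      by (intro mult_left_mono sum_mono) (auto simp: block_norm_eq p_ge_1 intro!: dual_norm_sums_le)
    also have "\<dots> = (\<Sum>i. w * (\<Sum>m\<in>M. block_norm p j (y i) m))"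
      using block' by (simp add: suminf_sum suminf_mult summable_sum)
    also have "\<dots> \<le> (\<Sum>i. level_norm u p j (y i))"
      using block' by (intro suminf_le partial that summ summable_mult summable_sum) auto
    finally show ?thesis .
  qed
  show "z \<in> level_space p j" "level_norm u p j z \<le> (\<Sum>i. level_norm u p j (y i))"
    by (rule level_normI[OF *[unfolded w_def]], assumption)+
qed

text \<open>Cover \<open>F\<close> by the blocks that meet it, use subadditivity over blocks, and
  compare norms on each block. The power of its cardinality produced there equals the weight in the
  level norm.\<close>

lemma pnorm_le_level_norm:
  fixes y :: "int ^ 'd \<Rightarrow> complex"
  assumes "y \<in> level_space p j" "finite F"
  shows "pnorm u' F y \<le> level_norm u p j y"
proof -
  have weight: "real (card (subcubes j m)) powr (1 / p - 1 / u)
      = 2 powr (real j * real CARD('d) * (1 / p - 1 / u))" for m :: "int ^ 'd"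
    by (simp add: card_subcubes powr_powr flip: powr_realpow)
  have "pnorm u' F y \<le> pnorm u' (\<Union>m\<in>parent j ` F. subcubes j m) y"
    using u'_ge_1 assms(2) by (intro pnorm_subset) (auto, auto simp: subcubes_eq)
  also have "\<dots> \<le> (\<Sum>m\<in>parent j ` F. pnorm u' (subcubes j m) y)"
    using u'_ge_1 assms(2) by (intro pnorm_UN) auto
  also have "\<dots> \<le> (\<Sum>m\<in>parent j ` F. 2 powr (real j * real CARD('d) * (1 / p - 1 / u)) * block_norm p j y m)"
  proof (rule sum_mono)
    fix m :: "int ^ 'd"
    show "pnorm u' (subcubes j m) y \<le> 2 powr (real j * real CARD('d) * (1 / p - 1 / u)) * block_norm p j y m"
      using pnorm_le_dual_norm[OF p_ge_1 p_less_u conjugate finite_subcubes, of j m y]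
      by (simp only: weight block_norm_eq)
  qed
  also have "\<dots> \<le> level_norm u p j y"
    unfolding sum_distrib_left[symmetric] using assms by (intro level_partial_sum_le) auto
  finally show ?thesis .
qed

lemma cmod_le_level_norm: "y \<in> level_space p j \<Longrightarrow> cmod (y k) \<le> level_norm u p j y"
  using pnorm_le_level_norm[of y j "{k}"] u'_ge_1 by simp

lemma level_norm_remove_coords_le:
  assumes "y \<in> level_space p j"
  shows "remove_coords F y \<in> level_space p j"
    "level_norm u p j (remove_coords F y) \<le> level_norm u p j y"
  by (intro level_norm_mono[OF assms]; simp add: remove_coords_def)+

text \<open>Finitely many blocks carry all but \<open>e / w\<close> of the sum of block norms.
  Removing them entirely makes their norms 0, and removing further coordinates cannot increase the
  others, so the bound is uniform in \<open>F\<close>.\<close>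

lemma level_norm_remove_coords_small:
  fixes y :: "int ^ 'd \<Rightarrow> complex"
  assumes y: "y \<in> level_space p j" and "0 < e"
  obtains F0 where "finite F0" "\<And>F. F0 \<subseteq> F \<Longrightarrow> level_norm u p j (remove_coords F y) \<le> e"
proof -
  define w where "w = (2::real) powr (real j * real CARD('d) * (1 / p - 1 / u))"
  have "0 < w" by (simp add: w_def)
  have summ: "block_norm p j y summable_on UNIV"
    using y by (simp add: level_space_def)
  obtain M where M: "finite M"
      "dist (\<Sum>m\<in>M. block_norm p j y m) (\<Sum>\<^sub>\<infinity>m. block_norm p j y m) \<le> e / w"
    using infsum_finite_approximation[OF summ, of "e / w"] \<open>0 < e\<close> \<open>0 < w\<close> by auto
  show thesis
  proof
    show "finite (\<Union>m\<in>M. subcubes j m)" using M by simp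
    fix F assume F: "(\<Union>m\<in>M. subcubes j m) \<subseteq> F"
    have "w * (\<Sum>m\<in>M'. block_norm p j (remove_coords F y) m) \<le> e" if "finite M'" for M'
    proof -
      have "(\<Sum>m\<in>M'. block_norm p j (remove_coords F y) m) \<le> (\<Sum>m\<in>M' - M. block_norm p j y m)"
      proof -
        have zero: "block_norm p j (remove_coords F y) m = 0" if "m \<in> M" for m
          unfolding block_norm_eq using that F
          by (intro dual_norm_zero p_ge_1) (auto simp: remove_coords_def)
        have "(\<Sum>m\<in>M'. block_norm p j (remove_coords F y) m)
            = (\<Sum>m\<in>M' - M. block_norm p j (remove_coords F y) m)"
          using zero that by (intro sum.mono_neutral_right) auto
        also have "\<dots> \<le> (\<Sum>m\<in>M' - M. block_norm p j y m)"
          unfolding block_norm_eq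
          by (intro sum_mono dual_norm_mono p_ge_1) (auto simp: remove_coords_def)
        finally show ?thesis .
      qed
      \<comment> \<open>Adding the blocks of \<open>M\<close> and subtracting their sum again bounds
        this by the total minus the sum over \<open>M\<close>, a quantity independent of
        \<open>M'\<close>.\<close>
      also have "(\<Sum>m\<in>M' - M. block_norm p j y m)
          = (\<Sum>m\<in>M' \<union> M. block_norm p j y m) - (\<Sum>m\<in>M. block_norm p j y m)"
        using that M sum.subset_diff[of M "M' \<union> M" "block_norm p j y"] by (simp add: Un_Diff)
      also have "\<dots> \<le> (\<Sum>\<^sub>\<infinity>m. block_norm p j y m) - (\<Sum>m\<in>M. block_norm p j y m)"
        using finite_sum_le_infsum[OF summ, of "M' \<union> M"] that M by (simp add: block_norm_nonneg)
      also have "\<dots> \<le> e / w"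
        using M(2) by (simp add: dist_real_def)
      finally show ?thesis
        using \<open>0 < w\<close> by (simp add: field_simps)
    qed
    then show "level_norm u p j (remove_coords F y) \<le> e"
      unfolding w_def by (rule level_normI)
  qed
qed

section \<open>The sum of the level spaces\<close>

lemma X_norm_bdd: "bdd_below ((\<lambda>y. \<Sum>j. level_norm u p j (y j)) ` {y. decomposition u p x y})"
  by (rule bdd_belowI2[of _ 0]) (auto simp: decomposition_def intro!: suminf_nonneg level_norm_nonneg)

lemma decomposition_in_X: "decomposition u p x y \<Longrightarrow> x \<in> X_space u p"
  by (auto simp: X_space_def)

lemma X_norm_le: "decomposition u p x y \<Longrightarrow> X_norm u p x \<le> (\<Sum>j. level_norm u p j (y j))"
  unfolding X_norm_def by (rule cINF_lower[OF X_norm_bdd]) simp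

text \<open>No minimising decomposition is assumed to exist; estimates pass through a decomposition
  with total below an arbitrary \<open>C\<close> above the norm.\<close>

lemma X_norm_approx:
  assumes "x \<in> X_space u p" "X_norm u p x < C"
  obtains y where "decomposition u p x y" "(\<Sum>j. level_norm u p j (y j)) < C"
proof -
  have "{y. decomposition u p x y} \<noteq> {}"
    using assms by (auto simp: X_space_def)
  then show thesis
    using assms(2) that cINF_less_iff[OF _ X_norm_bdd] unfolding X_norm_def by blast
qed

text \<open>The levelwise bounds are added along a nearly optimal decomposition, and then
  \<open>C\<close> is lowered to the norm of \<open>x\<close>.\<close>

lemma pnorm_le_X_norm:
  assumes "x \<in> X_space u p" "finite F"
  shows "pnorm u' F x \<le> X_norm u p x"
proof (rule dense_ge)
  fix C assume "X_norm u p x < C"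
  then obtain y where y: "decomposition u p x y" "(\<Sum>j. level_norm u p j (y j)) < C"
    using assms X_norm_approx by blast
  have le: "pnorm u' F (y j) \<le> level_norm u p j (y j)" for j
    using y assms by (intro pnorm_le_level_norm) (auto simp: decomposition_def)
  have summ: "summable (\<lambda>j. level_norm u p j (y j))"
    using y by (simp add: decomposition_def)
  have summ': "summable (\<lambda>j. pnorm u' F (y j))"
    using le by (intro summable_comparison_test'[OF summ, of 0]) (simp add: pnorm_nonneg)
  have "pnorm u' F x \<le> (\<Sum>j. pnorm u' F (y j))"
    using y assms u'_ge_1 by (intro pnorm_sums_le summ') (auto simp: decomposition_def)
  also have "\<dots> \<le> (\<Sum>j. level_norm u p j (y j))"
    by (intro suminf_le le summ summ')
  finally show "pnorm u' F x \<le> C" using y by simp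
qed

text \<open>Coordinate functionals are bounded by the norm. This yields definiteness, uniqueness of
  expansion coefficients, and coordinatewise convergence in the completeness proof.\<close>

lemma cmod_le_X_norm: "x \<in> X_space u p \<Longrightarrow> cmod (x k) \<le> X_norm u p x"
  using pnorm_le_X_norm[of x "{k}"] u'_ge_1 by simp

lemma X_norm_nonneg: "x \<in> X_space u p \<Longrightarrow> 0 \<le> X_norm u p x"
  using cmod_le_X_norm norm_ge_zero order_trans by blast

text \<open>At level 0 every block is a single point and the weight is 1, so the level norm is the
  \<open>ell 1\<close> norm and \<open>x\<close> alone is a decomposition.\<close>

lemma ell_1_in_X:
  assumes "x \<in> ell 1"
  shows "x \<in> X_space u p" "X_norm u p x \<le> ell_norm 1 x"
proof -
  define y where "y j = (if j = 0 then x else (\<lambda>_. 0))" for j :: nat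
  have block: "block_norm p 0 x = (\<lambda>m. cmod (x m))"
    using conj_exponent_gt_1[of p] p_ge_1
    by (auto simp: block_norm_eq dual_norm_def fun_eq_iff)
  have level: "x \<in> level_space p 0" "level_norm u p 0 x = ell_norm 1 x"
    using assms by (simp_all add: level_space_def level_norm_def block ell_def ell_norm_def infsum_nonneg)
  have norms: "level_norm u p j (y j) = (if j = 0 then ell_norm 1 x else 0)" for j
    by (simp add: y_def level zero_level)
  have "(\<lambda>j. y j k) = (\<lambda>j. if j = 0 then x k else 0)" for k
    by (auto simp: y_def)
  then have "decomposition u p x y"
    using level sums_single[of 0 "\<lambda>_. x _"] sums_single[of 0 "\<lambda>_. ell_norm 1 x"]
    by (auto simp: decomposition_def norms sums_iff) (simp add: y_def zero_level)
  moreover have "(\<Sum>j. level_norm u p j (y j)) = ell_norm 1 x"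
    unfolding norms using sums_single[of 0 "\<lambda>_. ell_norm 1 x"] by (simp add: sums_iff)
  ultimately show "x \<in> X_space u p" "X_norm u p x \<le> ell_norm 1 x"
    using X_norm_le decomposition_in_X by fastforce+
qed

lemma X_cscale:
  assumes "x \<in> X_space u p"
  shows "cscale c x \<in> X_space u p \<and> X_norm u p (cscale c x) \<le> cmod c * X_norm u p x"
proof -
  have scaled: "decomposition u p (cscale c x) (\<lambda>j. cscale c (y j))"
    "(\<Sum>j. level_norm u p j (cscale c (y j))) = cmod c * (\<Sum>j. level_norm u p j (y j))"
    if "decomposition u p x y" for y
  proof -
    have "level_norm u p j (cscale c (y j)) = cmod c * level_norm u p j (y j)" for j
      using that by (auto simp: decomposition_def level_norm_cscale)
    then show "decomposition u p (cscale c x) (\<lambda>j. cscale c (y j))"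
      "(\<Sum>j. level_norm u p j (cscale c (y j))) = cmod c * (\<Sum>j. level_norm u p j (y j))"
      using that
      by (auto simp: decomposition_def level_norm_cscale suminf_mult summable_mult)
        (simp add: cscale_def sums_mult)
  qed
  have less_imp: "X_norm u p (cscale c x) \<le> cmod c * C" if C: "X_norm u p x < C" for C
  proof -
    obtain y where y: "decomposition u p x y" "(\<Sum>j. level_norm u p j (y j)) < C"
      using X_norm_approx[OF assms C] .
    have "X_norm u p (cscale c x) \<le> cmod c * (\<Sum>j. level_norm u p j (y j))"
      using X_norm_le scaled y by metis
    also have "\<dots> \<le> cmod c * C"
      using y by (intro mult_left_mono) auto
    finally show ?thesis .
  qed
  have "X_norm u p (cscale c x) \<le> cmod c * X_norm u p x + e" if "0 < e" for e
  proof -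
    \<comment> \<open>Dividing by \<open>cmod c + 1\<close> instead of \<open>cmod c\<close> covers
      \<open>c = 0\<close> as well.\<close>
    have "X_norm u p (cscale c x) \<le> cmod c * (X_norm u p x + e / (cmod c + 1))"
      using that by (intro less_imp) (simp add: add_nonneg_pos)
    also have "\<dots> \<le> cmod c * X_norm u p x + e"
      using that by (simp add: distrib_left divide_le_eq add_nonneg_pos)
    finally show ?thesis .
  qed
  then have "X_norm u p (cscale c x) \<le> cmod c * X_norm u p x"
    by (rule field_le_epsilon)
  moreover have "cscale c x \<in> X_space u p"
    using assms scaled decomposition_in_X by (auto simp: X_space_def)
  ultimately show ?thesis by blast
qed

text \<open>
  Decompositions of the terms are added level by level; the double series of coordinates
  converges absolutely because each level norm dominates every coordinate.
\<close>

lemma X_sums_le_strict: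
  fixes d :: "nat \<Rightarrow> int ^ 'd \<Rightarrow> complex"
  assumes d: "\<And>i. d i \<in> X_space u p" "\<And>i. X_norm u p (d i) < c i" and c: "summable c"
    and sums: "\<And>k. (\<lambda>i. d i k) sums x k"
  shows "x \<in> X_space u p \<and> X_norm u p x \<le> (\<Sum>i. c i)"
proof -
  \<comment> \<open>The strict bound on the norm permits a choice, for each \<open>i\<close>, of a
    decomposition with total below \<open>c i\<close>.\<close>
  have "\<exists>y. decomposition u p (d i) y \<and> (\<Sum>j. level_norm u p j (y j)) < c i" for i
    using X_norm_approx[OF d] by metis
  then obtain y where dec: "\<And>i. decomposition u p (d i) (y i)"
      and less: "\<And>i. (\<Sum>j. level_norm u p j (y i j)) < c i"
    by metis
  define L where "L i j = level_norm u p j (y i j)" for i j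
  have L_nonneg: "0 \<le> L i j" for i j by (simp add: L_def level_norm_nonneg)
  have rows: "summable (L i)" for i
    using dec[of i] by (simp add: decomposition_def L_def[abs_def])
  have row_le: "(\<Sum>j. L i j) \<le> c i" for i
    using less[of i] by (simp add: L_def[abs_def])
  have row_sums: "summable (\<lambda>i. \<Sum>j. L i j)"
    using row_le L_nonneg by (intro summable_comparison_test'[OF c, of 0]) (auto simp: suminf_nonneg rows)
  have level: "y i j \<in> level_space p j" for i j
    using dec[of i] by (simp add: decomposition_def)
  have L_le: "L i j \<le> c i" for i j
    using sum_le_suminf[OF rows, of "{j}" i] row_le[of i] L_nonneg by force
  have cols: "summable (\<lambda>i. L i j)" for j
    using L_le L_nonneg by (intro summable_comparison_test'[OF c, of 0]) auto
  have y_le: "cmod (y i j k) \<le> L i j" for i j k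
    unfolding L_def by (intro cmod_le_level_norm level)

  have Lpair: "(\<lambda>(i, j). L i j) summable_on UNIV \<times> UNIV"
  proof (rule summable_on_SigmaI)
    show "((\<lambda>j. case (i, j) of (i, j) \<Rightarrow> L i j) has_sum (\<Sum>j. L i j)) UNIV" for i
      using rows[of i] L_nonneg by (auto intro!: sums_nonneg_imp_has_sum simp: summable_sums)
    show "(\<lambda>i. \<Sum>j. L i j) summable_on UNIV"
      using row_sums L_nonneg by (intro summable_nonneg_imp_summable_on) (auto simp: suminf_nonneg rows)
  qed (use L_nonneg in auto)
  define z where "z j k = (\<Sum>i. y i j k)" for j k
  have z_sums: "(\<lambda>i. y i j k) sums z j k" for j k
    unfolding z_def
    by (intro summable_sums summable_comparison_test'[OF cols[of j], of 0]) (use y_le in auto)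
  \<comment> \<open>The two iterated sums of \<open>y i j k\<close> agree: summing over
    \<open>j\<close> first gives \<open>d i k\<close>, summing over \<open>i\<close> first gives
    \<open>z j k\<close>.\<close>
  have z_total: "(\<lambda>j. z j k) sums x k" for k
  proof -
    have pair: "(\<lambda>(i, j). y i j k) summable_on UNIV \<times> UNIV"
      using y_le
      by (intro abs_summable_summable[OF Infinite_Sum.abs_summable_on_comparison_test'[OF Lpair]]) (simp add: case_prod_beta)
    have "(\<lambda>(j, i). y i j k) summable_on UNIV \<times> UNIV"
      using pair by (subst summable_on_swap) (simp add: case_prod_unfold)
    then have outer: "(\<lambda>j. \<Sum>\<^sub>\<infinity>i. y i j k) summable_on UNIV"
      by (rule summable_on_Sigma_banach)
    have inf_eq: "(\<Sum>\<^sub>\<infinity>i. y i j k) = z j k" for j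
    proof -
      have "((\<lambda>i. y i j k) has_sum z j k) UNIV"
        using z_sums y_le by (intro norm_summable_imp_has_sum summable_comparison_test'[OF cols[of j], of 0]) auto
      then show ?thesis by (rule infsumI)
    qed
    have inf_eq': "(\<Sum>\<^sub>\<infinity>j. y i j k) = d i k" for i
    proof -
      have "((\<lambda>j. y i j k) has_sum d i k) UNIV"
        using dec[of i] y_le
        by (intro norm_summable_imp_has_sum summable_comparison_test'[OF rows[of i], of 0])
          (auto simp: decomposition_def)
      then show ?thesis by (rule infsumI)
    qed
    have "(\<lambda>i. d i k) summable_on UNIV"
      using summable_on_Sigma_banach[OF pair] by (simp add: inf_eq')
    then have "(\<lambda>i. d i k) sums (\<Sum>\<^sub>\<infinity>i. d i k)"
      by (intro has_sum_imp_sums has_sum_infsum)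
    then have "(\<Sum>\<^sub>\<infinity>i. d i k) = x k"
      using sums sums_unique2 by blast
    moreover have "(\<Sum>\<^sub>\<infinity>i. d i k) = (\<Sum>\<^sub>\<infinity>j. z j k)"
      using infsum_swap_banach[OF pair] by (simp add: inf_eq inf_eq')
    moreover have "(\<lambda>j. z j k) sums (\<Sum>\<^sub>\<infinity>j. z j k)"
      using outer unfolding inf_eq by (intro has_sum_imp_sums has_sum_infsum)
    ultimately show ?thesis by simp
  qed
  have z: "z j \<in> level_space p j" "level_norm u p j (z j) \<le> (\<Sum>i. L i j)" for j
    using level_norm_sums_le[of "\<lambda>i. y i j" j "z j"] level z_sums cols[of j] by (auto simp: L_def)
  \<comment> \<open>With only finitely many levels, the sum over levels moves inside the series over
    \<open>i\<close>, where each row is at most \<open>c i\<close>.\<close>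
  have partial: "(\<Sum>j<n. level_norm u p j (z j)) \<le> (\<Sum>i. c i)" for n
  proof -
    have "(\<Sum>j<n. level_norm u p j (z j)) \<le> (\<Sum>j<n. \<Sum>i. L i j)"
      by (intro sum_mono z)
    also have "\<dots> = (\<Sum>i. \<Sum>j<n. L i j)"
      by (intro suminf_sum[symmetric] cols)
    also have "\<dots> \<le> (\<Sum>i. c i)"
    proof (intro suminf_le c summable_sum cols)
      show "(\<Sum>j<n. L i j) \<le> c i" for i
        using sum_le_suminf[OF rows, of "{..<n}" i] row_le[of i] L_nonneg by force
    qed
    finally show ?thesis .
  qed
  have z_summable: "summable (\<lambda>j. level_norm u p j (z j))"
    by (intro summableI_nonneg_bounded[OF _ partial] level_norm_nonneg)
  have "decomposition u p x z"
    using z z_total z_summable by (simp add: decomposition_def)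
  moreover have "(\<Sum>j. level_norm u p j (z j)) \<le> (\<Sum>i. c i)"
    by (intro suminf_le_const z_summable partial)
  ultimately show ?thesis
    using X_norm_le[of x z] decomposition_in_X[of x z] by linarith
qed

text \<open>The strict version applies after the \<open>i\<close>-th norm is enlarged by
  \<open>e / 2 ^ (i + 1)\<close>; these enlargements add up to \<open>e\<close>, which is
  arbitrary.\<close>

lemma X_sums_le:
  fixes d :: "nat \<Rightarrow> int ^ 'd \<Rightarrow> complex"
  assumes d: "\<And>i. d i \<in> X_space u p" and summ: "summable (\<lambda>i. X_norm u p (d i))"
    and sums: "\<And>k. (\<lambda>i. d i k) sums x k"
  shows "x \<in> X_space u p \<and> X_norm u p x \<le> (\<Sum>i. X_norm u p (d i))"
proof -
  have geo: "summable (\<lambda>i. e * (1 / 2) ^ Suc i)" "(\<Sum>i. e * (1 / 2) ^ Suc i) = e" for e :: real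
    using sums_mult[OF power_half_series, of e] by (simp_all add: sums_iff)
  have "x \<in> X_space u p \<and> X_norm u p x \<le> (\<Sum>i. X_norm u p (d i)) + e" if "0 < e" for e
  proof -
    have "(\<Sum>i. X_norm u p (d i) + e * (1 / 2) ^ Suc i) = (\<Sum>i. X_norm u p (d i)) + e"
      by (subst suminf_add[OF summ geo(1), symmetric]) (simp only: geo)
    then show ?thesis
      using that X_sums_le_strict[of d "\<lambda>i. X_norm u p (d i) + e * (1 / 2) ^ Suc i" x]
        summable_add[OF summ geo(1)] d sums by simp
  qed
  then show ?thesis
    by (meson field_le_epsilon zero_less_one)
qed

lemma normed_space_X: "normed_space (X_space u p :: (int ^ 'd \<Rightarrow> complex) set) (X_norm u p)"
proof (rule normed_spaceI)
  have "(0 :: int ^ 'd \<Rightarrow> complex) \<in> ell 1" "ell_norm 1 (0 :: int ^ 'd \<Rightarrow> complex) = 0"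
    using normed_space_ell[of 1] by (auto simp: normed_space_def)
  then show zero: "(0 :: int ^ 'd \<Rightarrow> complex) \<in> X_space u p"
      and zero_le: "X_norm u p (0 :: int ^ 'd \<Rightarrow> complex) \<le> 0"
    using ell_1_in_X[of "0 :: int ^ 'd \<Rightarrow> complex"] by auto
  fix x :: "int ^ 'd \<Rightarrow> complex" assume x: "x \<in> X_space u p"
  show "cscale c x \<in> X_space u p \<and> X_norm u p (cscale c x) \<le> cmod c * X_norm u p x" for c
    by (rule X_cscale[OF x])
  show "cmod (x k) \<le> X_norm u p x" for k
    by (rule cmod_le_X_norm[OF x])
  fix y :: "int ^ 'd \<Rightarrow> complex" assume y: "y \<in> X_space u p"
  \<comment> \<open>The triangle inequality is countable subadditivity for a series with at most two
    nonzero terms.\<close>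
  define d where "d i = (if i = 0 then x else if i = 1 then y else 0)" for i :: nat
  have "X_norm u p (0 :: int ^ 'd \<Rightarrow> complex) = 0"
    using zero_le X_norm_nonneg[OF zero] by simp
  then have "(\<lambda>i. X_norm u p (d i)) sums (\<Sum>i<2. X_norm u p (d i))"
    by (intro sums_finite) (auto simp: d_def)
  moreover have "(\<lambda>i. d i k) sums (\<Sum>i<2. d i k)" for k
    by (intro sums_finite) (auto simp: d_def)
  ultimately show "x + y \<in> X_space u p \<and> X_norm u p (x + y) \<le> X_norm u p x + X_norm u p y"
    using X_sums_le[of d "x + y"] x y zero
    by (auto simp: d_def sums_iff numeral_2_eq_2)
qed

section \<open>Truncation and the unit basis\<close>

text \<open>From level \<open>J\<close> on, the tail of a decomposition is small and truncation does
  not enlarge it; each of the finitely many earlier levels becomes small once enough coordinates are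
  removed.\<close>

lemma X_norm_remove_coords_small:
  fixes x :: "int ^ 'd \<Rightarrow> complex"
  assumes x: "x \<in> X_space u p" and "0 < e"
  obtains F0 where "finite F0"
    "\<And>F. F0 \<subseteq> F \<Longrightarrow> remove_coords F x \<in> X_space u p \<and> X_norm u p (remove_coords F x) < e"
proof -
  obtain y where y: "decomposition u p x y"
    using x by (auto simp: X_space_def)
  then have level: "\<And>j. y j \<in> level_space p j" and summ: "summable (\<lambda>j. level_norm u p j (y j))"
    by (auto simp: decomposition_def)
  obtain J where J: "\<And>n. n \<ge> J \<Longrightarrow> norm (\<Sum>i. level_norm u p (i + n) (y (i + n))) < e / 2"
    using suminf_exist_split[OF _ summ, of "e / 2"] \<open>0 < e\<close> by auto
  \<comment> \<open>The \<open>J\<close> early levels together contribute at most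
    \<open>e / 2\<close>; the added 1 avoids division by 0 when \<open>J = 0\<close>.\<close>
  define e' where "e' = e / (2 * (real J + 1))"
  have "0 < e'" using \<open>0 < e\<close> by (simp add: e'_def)
  have "\<exists>F0. finite F0 \<and> (\<forall>F. F0 \<subseteq> F \<longrightarrow> level_norm u p j (remove_coords F (y j)) \<le> e')" for j
    using level_norm_remove_coords_small[OF level[of j] \<open>0 < e'\<close>] by metis
  then obtain G where G: "\<And>j. finite (G j)"
      "\<And>j F. G j \<subseteq> F \<Longrightarrow> level_norm u p j (remove_coords F (y j)) \<le> e'"
    by metis
  show thesis
  proof
    show "finite (\<Union>j<J. G j)" using G by blast
    fix F assume F: "(\<Union>j<J. G j) \<subseteq> F"
    let ?r = "\<lambda>j. level_norm u p j (remove_coords F (y j))"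
    note removed = level_norm_remove_coords_le[OF level, where F = F]
    have summ': "summable ?r"
      using removed by (intro summable_comparison_test'[OF summ, of 0]) (simp add: level_norm_nonneg)
    have "(\<lambda>j. remove_coords F (y j) k) sums remove_coords F x k" for k
      using y by (auto simp: decomposition_def remove_coords_def)
    then have dec: "decomposition u p (remove_coords F x) (\<lambda>j. remove_coords F (y j))"
      using removed summ' by (simp add: decomposition_def)
    have "(\<Sum>j. ?r j) = (\<Sum>j. ?r (j + J)) + (\<Sum>j<J. ?r j)"
      by (rule suminf_split_initial_segment[OF summ'])
    also have "(\<Sum>j. ?r (j + J)) \<le> (\<Sum>j. level_norm u p (j + J) (y (j + J)))"
      using removed summable_ignore_initial_segment[OF summ, of J]
        summable_ignore_initial_segment[OF summ', of J] by (intro suminf_le) auto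
    also have "\<dots> < e / 2"
      using J[of J] by (simp add: abs_less_iff)
    also have "(\<Sum>j<J. ?r j) \<le> (\<Sum>j<J. e')"
      using F by (intro sum_mono G) auto
    also have "\<dots> \<le> e / 2"
      using \<open>0 < e\<close> by (simp add: e'_def field_simps)
    finally have "(\<Sum>j. ?r j) < e" by simp
    then show "remove_coords F x \<in> X_space u p \<and> X_norm u p (remove_coords F x) < e"
      using X_norm_le[OF dec] decomposition_in_X[OF dec] by simp
  qed
qed

lemma X_in_ell:
  assumes "x \<in> X_space u p"
  shows "x \<in> ell u'" "ell_norm u' x \<le> X_norm u p x"
  using ell_normI[OF _ X_norm_nonneg[OF assms] pnorm_le_X_norm[OF assms]] u'_ge_1 by auto

text \<open>The norm is squeezed between the coordinate at \<open>n\<close> and the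
  \<open>ell 1\<close> norm, both equal to 1.\<close>

lemma unit_seq_in_X: "unit_seq n \<in> X_space u p" "X_norm u p (unit_seq n) = 1"
proof -
  show X: "unit_seq n \<in> X_space u p"
    by (intro ell_1_in_X(1) unit_seq_in_ell(1)) simp
  have "X_norm u p (unit_seq n) \<le> 1"
    using ell_1_in_X(2)[OF unit_seq_in_ell(1)[OF zero_less_one], of n]
    by (simp add: unit_seq_in_ell(2))
  then show "X_norm u p (unit_seq n) = 1"
    using cmod_le_X_norm[OF X, of n] by (simp add: unit_seq_def)
qed

lemma multiple_unit_seq_in_X: "cscale c (unit_seq n) \<in> X_space u p"
  using X_cscale unit_seq_in_X by blast

lemma unit_expansion_converges:
  fixes x :: "int ^ 'd \<Rightarrow> complex"
  assumes x: "x \<in> X_space u p" and "bij \<sigma>"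
  shows "series_converges_to (X_space u p) (X_norm u p) (\<lambda>n. cscale (x (\<sigma> n)) (unit_seq (\<sigma> n))) x"
proof -
  let ?S = "\<lambda>n. \<Sum>i<n. cscale (x (\<sigma> i)) (unit_seq (\<sigma> i))"
  have inj: "inj \<sigma>" and surj: "surj \<sigma>" using \<open>bij \<sigma>\<close> by (auto simp: bij_def)
  have S: "?S n \<in> X_space u p" for n
    by (intro normed_space_sum[OF normed_space_X] multiple_unit_seq_in_X)
  have rest: "x - ?S n = remove_coords (\<sigma> ` {..<n}) x" for n
  proof
    fix k
    obtain m where "k = \<sigma> m" using surj by (metis surjD)
    then show "(x - ?S n) k = remove_coords (\<sigma> ` {..<n}) x k"
      using unit_expansion_partial_sum[OF inj, where c = "\<lambda>i. x (\<sigma> i)"] inj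
      by (auto simp: remove_coords_def inj_eq)
  qed
  have "(\<lambda>n. X_norm u p (?S n - x)) \<longlonglongrightarrow> 0"
  proof (rule LIMSEQ_I)
    fix e :: real assume "0 < e"
    then obtain F0 where F0: "finite F0"
        "\<And>F. F0 \<subseteq> F \<Longrightarrow> remove_coords F x \<in> X_space u p \<and> X_norm u p (remove_coords F x) < e"
      using X_norm_remove_coords_small[OF x] by metis
    \<comment> \<open>Only \<open>n0\<close> depends on the enumeration; \<open>F0\<close> was
      chosen from \<open>x\<close> and \<open>e\<close> alone.\<close>
    obtain n0 where n0: "inv \<sigma> ` F0 \<subseteq> {..<n0}"
      using finite_nat_iff_bounded F0(1) by blast
    have "norm (X_norm u p (?S n - x) - 0) < e" if "n0 \<le> n" for n
    proof -
      have "F0 \<subseteq> \<sigma> ` {..<n}"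
      proof
        fix k assume "k \<in> F0"
        then have "inv \<sigma> k < n" using n0 that by fastforce
        then show "k \<in> \<sigma> ` {..<n}"
          using surj_f_inv_f[OF surj, of k] by (metis imageI lessThan_iff)
      qed
      then have "remove_coords (\<sigma> ` {..<n}) x \<in> X_space u p \<and>
          X_norm u p (remove_coords (\<sigma> ` {..<n}) x) < e"
        by (rule F0)
      moreover have "X_norm u p (?S n - x) = X_norm u p (remove_coords (\<sigma> ` {..<n}) x)"
        using normed_space_minus(2)[OF normed_space_X S x] rest by metis
      ultimately show ?thesis
        using X_norm_nonneg by fastforce
    qed
    then show "\<exists>n0. \<forall>n\<ge>n0. norm (X_norm u p (?S n - x) - 0) < e" by blast
  qed
  then show ?thesis
    unfolding series_converges_to_def using x limitin_norm_topology[OF normed_space_X, of ?S, OF S] by blast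
qed

text \<open>The coordinate at \<open>\<sigma> m\<close> of every partial sum with
  \<open>n > m\<close> is \<open>c m\<close>, and it converges to that of \<open>x\<close> since
  coordinates are bounded by the norm.\<close>

lemma unit_expansion_unique:
  fixes x :: "int ^ 'd \<Rightarrow> complex"
  assumes "inj \<sigma>"
    and conv: "series_converges_to (X_space u p) (X_norm u p) (\<lambda>n. cscale (c n) (unit_seq (\<sigma> n))) x"
  shows "c m = x (\<sigma> m)"
proof -
  let ?S = "\<lambda>n. \<Sum>i<n. cscale (c i) (unit_seq (\<sigma> i))"
  have S: "?S n \<in> X_space u p" for n
    by (intro normed_space_sum[OF normed_space_X] multiple_unit_seq_in_X)
  have x: "x \<in> X_space u p" and lim: "(\<lambda>n. X_norm u p (?S n - x)) \<longlonglongrightarrow> 0"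
    using conv limitin_norm_topology[OF normed_space_X, of ?S, OF S] unfolding series_converges_to_def by blast+
  have "cmod (c m - x (\<sigma> m)) \<le> X_norm u p (?S n - x)" if "m < n" for n
    using cmod_le_X_norm[OF normed_space_minus(1)[OF normed_space_X S x], of n "\<sigma> m"] that
    by (simp add: unit_expansion_partial_sum[OF assms(1)])
  then have "cmod (c m - x (\<sigma> m)) \<le> 0"
    by (intro LIMSEQ_le_const[OF lim]) (meson Suc_le_eq)
  then show ?thesis by simp
qed

lemma unconditional_basis_unit_seq:
  "unconditional_basis (X_space u p :: (int ^ 'd \<Rightarrow> complex) set) (X_norm u p) unit_seq"
proof -
  \<comment> \<open>Constant vectors embed the naturals into the lattice, so the lattice is
    countably infinite and its enumeration is a bijection.\<close>
  have "inj (\<lambda>a :: nat. (\<chi> i. int a) :: int ^ 'd)"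
    by (auto simp: inj_def vec_eq_iff)
  then have "infinite (UNIV :: (int ^ 'd) set)"
    by (rule infinite_super[OF subset_UNIV range_inj_infinite])
  then have bij: "bij (from_nat_into (UNIV :: (int ^ 'd) set))"
    by (intro bij_betw_from_nat_into) auto
  have "\<exists>!c. series_converges_to (X_space u p) (X_norm u p)
      (\<lambda>n. cscale (c n) ((unit_seq \<circ> from_nat_into UNIV) n)) x"
    if "x \<in> X_space u p" for x :: "int ^ 'd \<Rightarrow> complex"
  proof (rule ex1I[of _ "\<lambda>n. x (from_nat_into UNIV n)"])
    show "series_converges_to (X_space u p) (X_norm u p)
        (\<lambda>n. cscale (x (from_nat_into UNIV n)) ((unit_seq \<circ> from_nat_into UNIV) n)) x"
      using unit_expansion_converges[OF that bij] by simp
  next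
    fix c assume "series_converges_to (X_space u p) (X_norm u p)
        (\<lambda>n. cscale (c n) ((unit_seq \<circ> from_nat_into UNIV) n)) x"
    then show "c = (\<lambda>n. x (from_nat_into UNIV n))"
      using unit_expansion_unique[OF bij_is_inj[OF bij]] by (simp add: fun_eq_iff)
  qed
  then have "schauder_basis (X_space u p :: (int ^ 'd \<Rightarrow> complex) set) (X_norm u p)
      (unit_seq \<circ> from_nat_into UNIV)"
    using unit_seq_in_X by (auto simp: schauder_basis_def)
  then show ?thesis
    using bij unit_expansion_converges unfolding unconditional_basis_def by blast
qed

section \<open>Completeness and separability\<close>

text \<open>An absolutely convergent series converges coordinatewise to some \<open>x\<close>. Its
  remainder is the coordinatewise sum of the shifted series, so countable subadditivity bounds the
  remainder by a tail of the norms.\<close>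

lemma banach_space_X: "banach_space (X_space u p :: (int ^ 'd \<Rightarrow> complex) set) (X_norm u p)"
proof (rule banach_spaceI[OF normed_space_X])
  fix d :: "nat \<Rightarrow> int ^ 'd \<Rightarrow> complex"
  assume d: "\<And>i. d i \<in> X_space u p" and summ: "summable (\<lambda>i. X_norm u p (d i))"
  define x where "x k = (\<Sum>i. d i k)" for k
  have coord: "summable (\<lambda>i. d i k)" for k
    using cmod_le_X_norm[OF d] by (intro summable_comparison_test'[OF summ, of 0])
  have tail: "x - (\<Sum>i<n. d i) \<in> X_space u p \<and>
      X_norm u p (x - (\<Sum>i<n. d i)) \<le> (\<Sum>i. X_norm u p (d (i + n)))" for n
  proof (rule X_sums_le)
    show "(\<lambda>i. d (i + n) k) sums (x - (\<Sum>i<n. d i)) k" for k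
      using sums_split_initial_segment[OF summable_sums[OF coord], of n k]
      by (simp add: x_def sum_fun_apply)
  qed (use d summable_ignore_initial_segment[OF summ] in auto)
  have x: "x \<in> X_space u p" using tail[of 0] by simp
  have "X_norm u p ((\<Sum>i<n. d i) - x) \<le> (\<Sum>i. X_norm u p (d (i + n)))" for n
    using tail[of n]
    by (subst normed_space_minus(2)[OF normed_space_X normed_space_sum[OF normed_space_X d] x]) simp
  moreover have "0 \<le> X_norm u p ((\<Sum>i<n. d i) - x)" for n
    by (intro X_norm_nonneg normed_space_minus[OF normed_space_X] normed_space_sum[OF normed_space_X] d x)
  ultimately have "(\<lambda>n. X_norm u p ((\<Sum>i<n. d i) - x)) \<longlonglongrightarrow> 0"
    by (intro Lim_null_comparison[OF _ suminf_exist_split2[OF summ]] always_eventually allI) simp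
  then show "\<exists>x\<in>X_space u p. (\<lambda>n. X_norm u p ((\<Sum>i<n. d i) - x)) \<longlonglongrightarrow> 0"
    using x by blast
qed

text \<open>Truncation approximates \<open>x\<close> by a finitely supported family, whose finitely
  many values are then replaced by nearby elements of a countable dense subset of the complex
  numbers.\<close>

lemma separable_space_X:
  "separable_space (norm_topology (X_space u p :: (int ^ 'd \<Rightarrow> complex) set) (X_norm u p))"
proof -
  define X where "X = (X_space u p :: (int ^ 'd \<Rightarrow> complex) set)"
  have normed: "normed_space X (X_norm u p)"
    unfolding X_def by (rule normed_space_X)
  interpret Metric_space X "norm_dist X (X_norm u p)"
    by (rule Metric_space_norm_dist[OF normed])
  obtain D :: "complex set" where D: "countable D"
      "\<And>U. open U \<Longrightarrow> U \<noteq> {} \<Longrightarrow> \<exists>d\<in>D. d \<in> U"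
    using countable_dense_setE by blast
  \<comment> \<open>Elements of \<open>PiE\<close> are \<open>undefined\<close> off
    \<open>F\<close>, hence the explicit extension by 0; each finite \<open>F\<close> contributes
    countably many families.\<close>
  define C where "C = (\<Union>F\<in>{F :: (int ^ 'd) set. finite F}.
      (\<lambda>f k. if k \<in> F then f k else 0) ` (PiE F (\<lambda>_. D)))"
  have "countable C"
    unfolding C_def using D(1)
    by (intro countable_UN countable_image countable_PiE)
      (use countable_Collect_finite in auto)
  have C_ell: "x \<in> ell 1" if "x \<in> C" for x
    using that by (auto simp: C_def intro!: finite_support_ell_1(1))
  then have "C \<subseteq> X"
    using ell_1_in_X by (auto simp: X_def)
  have "\<exists>y\<in>C. y \<in> mball x e" if x: "x \<in> X" and "0 < e" for x e
  proof -
    obtain F where F: "finite F" "remove_coords F x \<in> X" "X_norm u p (remove_coords F x) < e / 2"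
      using X_norm_remove_coords_small[of x "e / 2"] x \<open>0 < e\<close> unfolding X_def by (metis half_gt_zero order_refl)
    \<comment> \<open>The perturbation on \<open>F\<close> is measured in \<open>ell 1\<close>,
      which dominates \<open>X_norm\<close>: \<open>card F\<close> errors below
      \<open>\<delta>\<close> add up to at most \<open>e / 2\<close>, also for empty
      \<open>F\<close>.\<close>
    define \<delta> where "\<delta> = e / (2 * (real (card F) + 1))"
    have "0 < \<delta>" using \<open>0 < e\<close> by (simp add: \<delta>_def)
    have "\<exists>q\<in>D. cmod (x k - q) < \<delta>" for k
      using D(2)[of "ball (x k) \<delta>"] \<open>0 < \<delta>\<close> by (auto simp: dist_norm)
    then obtain q where q: "\<And>k. q k \<in> D" "\<And>k. cmod (x k - q k) < \<delta>"
      by metis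
    define y where "y k = (if k \<in> F then q k else 0)" for k
    have "y = (\<lambda>f k. if k \<in> F then f k else 0) (restrict q F)"
      by (auto simp: y_def)
    moreover have "restrict q F \<in> PiE F (\<lambda>_. D)"
      using q(1) by auto
    ultimately have "y \<in> C"
      unfolding C_def using F(1) by blast
    define h where "h k = (if k \<in> F then x k - q k else 0)" for k
    have h: "h \<in> ell 1" "ell_norm 1 h = (\<Sum>k\<in>F. cmod (h k))"
      by (intro finite_support_ell_1[OF F(1)]; simp add: h_def)+
    have "ell_norm 1 h \<le> (\<Sum>k\<in>F. \<delta>)"
      unfolding h(2) using q(2) by (intro sum_mono) (auto simp: h_def less_imp_le)
    also have "\<dots> \<le> e / 2"
      using \<open>0 < e\<close> by (simp add: \<delta>_def field_simps)
    finally have "h \<in> X" "X_norm u p h \<le> e / 2"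
      using ell_1_in_X[OF h(1)] by (auto simp: X_def)
    moreover have "x - y = remove_coords F x + h"
      by (auto simp: remove_coords_def h_def y_def)
    ultimately have "X_norm u p (x - y) < e"
      using normed_space_triangle[OF normed F(2), of h] F(3) by simp
    then have "y \<in> mball x e"
      using x \<open>y \<in> C\<close> \<open>C \<subseteq> X\<close> by (auto simp: norm_dist_def)
    then show ?thesis using \<open>y \<in> C\<close> by blast
  qed
  then have "mtopology closure_of C = X"
    unfolding metric_closure_of by auto
  then show ?thesis
    unfolding separable_space_def norm_topology_def X_def[symmetric]
    using \<open>countable C\<close> \<open>C \<subseteq> X\<close> by auto
qed

end

theorem proposition3p4:
  fixes p u u' :: real
  assumes "1 \<le> p" and "p < u" and "1 / u + 1 / u' = 1"
  defines "X \<equiv> (X_space u p :: (int ^ 'd \<Rightarrow> complex) set)"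
    and "N \<equiv> (X_norm u p :: (int ^ 'd \<Rightarrow> complex) \<Rightarrow> real)"
  shows
    "(continuously_embedded (ell 1) (ell_norm 1) X N \<and>
      continuously_embedded X N (ell u') (ell_norm u') \<and>
      embedding_norm (ell 1) (ell_norm 1) N = 1 \<and>
      embedding_norm X N (ell_norm u') = 1) \<and>
     (normalised N (unit_seq :: int ^ 'd \<Rightarrow> int ^ 'd \<Rightarrow> complex) \<and>
      unconditional_basis X N (unit_seq :: int ^ 'd \<Rightarrow> int ^ 'd \<Rightarrow> complex)) \<and>
     (banach_space X N \<and> separable_space (norm_topology X N))"
proof -
  interpret sequence_exponents p u u'
    using assms(1-3) by unfold_locales
  have "0 < u'" using u'_ge_1 by simp
  note unit = unit_seq_in_ell[OF zero_less_one] unit_seq_in_ell[OF \<open>0 < u'\<close>] unit_seq_in_X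
  have "continuously_embedded (ell 1) (ell_norm 1) X N"
    unfolding X_def N_def
    by (intro continuously_embeddedI normed_space_ell normed_space_X conjI ell_1_in_X) auto
  moreover have "continuously_embedded X N (ell u') (ell_norm u')"
    unfolding X_def N_def
    by (intro continuously_embeddedI normed_space_ell normed_space_X conjI X_in_ell u'_ge_1)
  moreover have "embedding_norm (ell 1) (ell_norm 1) N = 1"
    \<comment> \<open>A unit sequence has norm 1 in all three spaces, so it attains the supremum for
      both inclusions.\<close>
    unfolding N_def by (rule embedding_norm_eq_1[OF ell_1_in_X(2)]) (assumption | rule unit)+
  moreover have "embedding_norm X N (ell_norm u') = 1"
    unfolding X_def N_def by (rule embedding_norm_eq_1[OF X_in_ell(2)]) (assumption | rule unit)+
  moreover have "normalised N unit_seq"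
    unfolding N_def normalised_def by (simp add: unit_seq_in_X)
  ultimately show ?thesis
    using unconditional_basis_unit_seq banach_space_X separable_space_X
    unfolding X_def N_def by blast
qed

end
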